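(* For the specialization $e_n\mapsto q^{\binom n2}/n!$ ($n\ge0$), and for any partition $\lambda$ of a positive integer, $$m_\lambda=(1-q)^{|\lambda|-l(\lambda)}\,\frac{q^{n(\lambda)}}{(|\lambda|-1)!\;m(\lambda)!}\,J_\lambda,\qquad\text{with}\qquad J_\lambda(q)=(|\lambda|-1)!\,M_\lambda(q)\,q^{-n(\lambda)}.$$ This generalizes the formula $m_{(n)}=\frac{(1-q)^{n-1}}{(n-1)!}J_n$, which is the case $\lambda=(n)$, $J_{(n)}=J_n$. Moreover, $J_\lambda$ is a polynomial with coefficients in $\mathbb{Z}$, of order equal to zero (i.e. with nonzero constant term) and of degree equal to $\binom{|\lambda|-1}{2}+l(\lambda)-1-n(\lambda)$.
   Context: Let $\Lambda$ be the algebra of symmetric functions in $x_1,x_2,\dots$ over $\mathbb{Q}(q)$, with monomial symmetric functions $m_\lambda$ and elementary symmetric functions $e_n$ ($e_0=1$). The specialization considered is the $\mathbb{Q}(q)$-algebra homomorphism $\Lambda\to\mathbb{Q}(q)$ determined by $e_n\mapsto q^{\binom n2}/n!$; symmetric functions are identified with their images. For a partition $\lambda=(\lambda_1\ge\dots\ge\lambda_r>0)$: $|\lambda|=\lambda_1+\dots+\lambda_r$, $l(\lambda)=r$, $n(\lambda)=\sum_{i\ge1}(i-1)\lambda_i$; if $r_i$ is the number of parts of $\lambda$ equal to $i$, then $m(\lambda)!=r_1!\,r_2!\cdots$. $M_\lambda(q)\in\mathbb{Q}[q]$ is the polynomial defined by $m(\lambda)!\,m_\lambda=(1-q)^{|\lambda|-l(\lambda)}M_\lambda(q)$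 under this specialization. $J_n$ ($n\ge1$) is the polynomial characterized by $m_{(n)}=\frac{(1-q)^{n-1}}{(n-1)!}J_n(q)$ under this specialization; it is known to be the inversion enumerator of labelled trees on $n$ vertices. The order of a polynomial in $q$ is the smallest power of $q$ with nonzero coefficient. *)

theory Defs
  imports "HOL-Library.Poly_Mapping" "HOL-Library.Multiset"
    "HOL-Computational_Algebra.Computational_Algebra"
begin

section \<open>The algebra of symmetric functions\<close>

text \<open>
  A monomial in the variables \<open>x\<^sub>0, x\<^sub>1, \<dots>\<close> is given by its finitely supported exponent
  vector. A symmetric function is a formal (in general infinite) linear combination of monomials,
  given by its coefficients, that has bounded degree and is invariant under permuting the variables.
\<close>

type_synonym monom_exp = "nat \<Rightarrow>\<^sub>0 nat"

definition mdeg :: "monom_exp \<Rightarrow> nat" where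
  "mdeg a = sum (Poly_Mapping.lookup a) (Poly_Mapping.keys a)"

definition exponents :: "monom_exp \<Rightarrow> nat multiset" where
  "exponents a = image_mset (Poly_Mapping.lookup a) (mset_set (Poly_Mapping.keys a))"

lemma map_key_bij_inv:
  assumes "bij \<sigma>"
  shows "Poly_Mapping.map_key \<sigma> (Poly_Mapping.map_key (inv \<sigma>) a) = a"
    and "Poly_Mapping.map_key (inv \<sigma>) (Poly_Mapping.map_key \<sigma> a) = a"
  using assms
  by (auto intro!: poly_mapping_eqI
      simp: map_key.rep_eq bij_is_inj bij_imp_bij_inv bij_is_surj surj_f_inv_f)

lemma exponents_map_key:
  assumes "bij \<sigma>"
  shows "exponents (Poly_Mapping.map_key \<sigma> a) = exponents a"
proof -
  have inj: "inj \<sigma>" using assms by (rule bij_is_inj)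
  have 1: "image_mset \<sigma> (mset_set (\<sigma> -` Poly_Mapping.keys a)) = mset_set (Poly_Mapping.keys a)"
    using assms by (subst image_mset_mset_set)
      (auto simp: inj_on_def bij_def surj_image_vimage_eq intro: injD)
  have "exponents (Poly_Mapping.map_key \<sigma> a)
      = image_mset (Poly_Mapping.lookup a) (image_mset \<sigma> (mset_set (\<sigma> -` Poly_Mapping.keys a)))"
    unfolding exponents_def using inj
    by (simp add: keys_map_key map_key.rep_eq multiset.map_comp comp_def)
  then show ?thesis unfolding 1 exponents_def .
qed

lemma mdeg_conv_exponents: "mdeg a = sum_mset (exponents a)"
  by (simp add: mdeg_def exponents_def sum_unfold_sum_mset)

lemma mdeg_conv_sum:
  assumes "finite A" "Poly_Mapping.keys a \<subseteq> A"
  shows "mdeg a = sum (Poly_Mapping.lookup a) A"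
  unfolding mdeg_def using assms by (intro sum.mono_neutral_left) (auto simp: in_keys_iff)

lemma mdeg_add: "mdeg (a + b) = mdeg a + mdeg b"
proof -
  let ?A = "Poly_Mapping.keys a \<union> Poly_Mapping.keys b"
  have "Poly_Mapping.keys (a + b) \<subseteq> ?A" by (rule Poly_Mapping.keys_add)
  then show ?thesis
    by (simp add: mdeg_conv_sum[of ?A] lookup_add sum.distrib)
qed

typedef (overloaded) ('a :: zero) symfun =
  "{f :: monom_exp \<Rightarrow> 'a.
     (\<forall>\<sigma> a. bij \<sigma> \<longrightarrow> f (Poly_Mapping.map_key \<sigma> a) = f a) \<and>
     (\<exists>d. \<forall>a. f a \<noteq> 0 \<longrightarrow> mdeg a \<le> d)}"
  morphisms sf_coeff Abs_symfun
  by (intro exI[of _ "\<lambda>_. 0"]) auto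

setup_lifting type_definition_symfun

definition splits :: "monom_exp \<Rightarrow> (monom_exp \<times> monom_exp) set" where
  "splits a = {(b, c). b + c = a}"

lemma finite_splits [simp]: "finite (splits a)"
proof -
  let ?F = "{f :: nat \<Rightarrow> nat. \<forall>i. (i \<in> Poly_Mapping.keys a \<longrightarrow> f i \<in> {..mdeg a}) \<and>
    (i \<notin> Poly_Mapping.keys a \<longrightarrow> f i = 0)}"
  let ?B = "{b. \<exists>c. b + c = a}"
  have "finite ?F" by (intro finite_set_of_finite_funs) auto
  moreover have "Poly_Mapping.lookup ` ?B \<subseteq> ?F"
  proof (intro image_subsetI CollectI allI)
    fix b i assume "b \<in> ?B"
    then obtain c where c: "b + c = a" by blast
    have "Poly_Mapping.lookup b i \<le> mdeg b"
    proof (cases "i \<in> Poly_Mapping.keys b")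
      case True
      then show ?thesis unfolding mdeg_def by (intro member_le_sum) auto
    qed (simp add: in_keys_iff)
    also have "\<dots> \<le> mdeg a" using mdeg_add[of b c] c by simp
    finally show "(i \<in> Poly_Mapping.keys a \<longrightarrow> Poly_Mapping.lookup b i \<in> {..mdeg a}) \<and>
      (i \<notin> Poly_Mapping.keys a \<longrightarrow> Poly_Mapping.lookup b i = 0)"
      using lookup_add[of b c i] c by (simp add: in_keys_iff)
  qed
  ultimately have "finite (Poly_Mapping.lookup ` ?B)" by (rule finite_subset[rotated])
  moreover have "inj_on Poly_Mapping.lookup ?B"
    by (rule inj_onI) (rule poly_mapping_eqI, simp)
  ultimately have B: "finite ?B" by (rule finite_imageD)
  have "(b, c) \<in> ?B \<times> ?B" if "b + c = a" for b c
  proof -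
    have "c + b = a" using that by (simp only: add.commute)
    with that show ?thesis by blast
  qed
  then have "splits a \<subseteq> ?B \<times> ?B"
    unfolding splits_def by blast
  then show ?thesis by (rule finite_subset[OF _ finite_cartesian_product[OF B B]])
qed

instantiation symfun :: (comm_ring_1) comm_ring_1
begin

lift_definition zero_symfun :: "'a symfun" is "\<lambda>_. 0" by auto

lift_definition one_symfun :: "'a symfun" is "\<lambda>a. if a = 0 then 1 else 0"
proof (intro conjI allI impI)
  fix \<sigma> :: "nat \<Rightarrow> nat" and a :: monom_exp
  assume "bij \<sigma>"
  then have "Poly_Mapping.map_key \<sigma> a = 0 \<longleftrightarrow> a = 0"
    using map_key_bij_inv(2)[of \<sigma> a] by (auto simp: bij_is_inj bij_imp_bij_inv)
  then show "(if Poly_Mapping.map_key \<sigma> a = 0 then 1 else 0) = (if a = 0 then 1 else (0 :: 'a))"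
    by simp
qed (auto simp: mdeg_def)

lift_definition uminus_symfun :: "'a symfun \<Rightarrow> 'a symfun" is "\<lambda>f a. - f a" by auto

lift_definition plus_symfun :: "'a symfun \<Rightarrow> 'a symfun \<Rightarrow> 'a symfun" is "\<lambda>f g a. f a + g a"
proof (elim conjE exE, intro conjI)
  fix f g :: "monom_exp \<Rightarrow> 'a" and d e
  assume "\<forall>a. f a \<noteq> 0 \<longrightarrow> mdeg a \<le> d" "\<forall>a. g a \<noteq> 0 \<longrightarrow> mdeg a \<le> e"
  then have "mdeg a \<le> max d e" if "f a + g a \<noteq> 0" for a
    using that by (cases "f a = 0") (auto simp: le_max_iff_disj)
  then show "\<exists>d. \<forall>a. f a + g a \<noteq> 0 \<longrightarrow> mdeg a \<le> d" by blast
qed auto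

lift_definition minus_symfun :: "'a symfun \<Rightarrow> 'a symfun \<Rightarrow> 'a symfun" is "\<lambda>f g a. f a - g a"
proof (elim conjE exE, intro conjI)
  fix f g :: "monom_exp \<Rightarrow> 'a" and d e
  assume "\<forall>a. f a \<noteq> 0 \<longrightarrow> mdeg a \<le> d" "\<forall>a. g a \<noteq> 0 \<longrightarrow> mdeg a \<le> e"
  then have "mdeg a \<le> max d e" if "f a - g a \<noteq> 0" for a
    using that by (cases "f a = 0") (auto simp: le_max_iff_disj)
  then show "\<exists>d. \<forall>a. f a - g a \<noteq> 0 \<longrightarrow> mdeg a \<le> d" by blast
qed auto

lift_definition times_symfun :: "'a symfun \<Rightarrow> 'a symfun \<Rightarrow> 'a symfun"
  is "\<lambda>f g a. \<Sum>(b, c)\<in>splits a. f b * g c"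
proof (elim conjE exE, intro conjI allI impI)
  fix f g :: "monom_exp \<Rightarrow> 'a" and \<sigma> :: "nat \<Rightarrow> nat" and a
  assume \<sigma>: "bij \<sigma>"
    and sym: "\<forall>\<sigma> a. bij \<sigma> \<longrightarrow> f (Poly_Mapping.map_key \<sigma> a) = f a"
      "\<forall>\<sigma> a. bij \<sigma> \<longrightarrow> g (Poly_Mapping.map_key \<sigma> a) = g a"
  have \<sigma>': "bij (inv \<sigma>)" using \<sigma> by (rule bij_imp_bij_inv)
  note inj = bij_is_inj[OF \<sigma>] bij_is_inj[OF \<sigma>']
  let ?m = "Poly_Mapping.map_key \<sigma>" and ?m' = "Poly_Mapping.map_key (inv \<sigma>)"
  show "(\<Sum>(b, c)\<in>splits (?m a). f b * g c) = (\<Sum>(b, c)\<in>splits a. f b * g c)"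
    by (rule sum.reindex_bij_witness[where j = "map_prod ?m' ?m'" and i = "map_prod ?m ?m"])
      (use \<sigma> \<sigma>' sym inj in \<open>auto simp: splits_def map_key_bij_inv map_key_plus[symmetric]\<close>)
next
  fix f g :: "monom_exp \<Rightarrow> 'a" and d e
  assume f: "\<forall>a. f a \<noteq> 0 \<longrightarrow> mdeg a \<le> d" and g: "\<forall>a. g a \<noteq> 0 \<longrightarrow> mdeg a \<le> e"
  show "\<exists>d. \<forall>a. (\<Sum>(b, c)\<in>splits a. f b * g c) \<noteq> 0 \<longrightarrow> mdeg a \<le> d"
  proof (intro exI[of _ "d + e"] allI impI)
    fix a assume "(\<Sum>(b, c)\<in>splits a. f b * g c) \<noteq> 0"
    then obtain p where "p \<in> splits a" "(case p of (b, c) \<Rightarrow> f b * g c) \<noteq> 0"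
      by (rule sum.not_neutral_contains_not_neutral)
    then obtain b c where "(b, c) \<in> splits a" "f b * g c \<noteq> 0"
      by (cases p) auto
    moreover from this have "f b \<noteq> 0" "g c \<noteq> 0" by auto
    ultimately show "mdeg a \<le> d + e"
      using f g by (auto simp: splits_def mdeg_add add_mono)
  qed
qed

instance
proof
  fix f g h :: "'a symfun"
  show "f + g + h = f + (g + h)" "f + g = g + f" "0 + f = f" "- f + f = 0" "f - g = f + - g"
    by (transfer, simp add: algebra_simps)+
  show "(0 :: 'a symfun) \<noteq> 1"
    by transfer (simp add: fun_eq_iff exI[of _ 0])
  show "f * g * h = f * (g * h)"
  proof transfer
    fix f g h :: "monom_exp \<Rightarrow> 'a"
    show "(\<lambda>a. \<Sum>(b, c)\<in>splits a. (\<Sum>(b, c)\<in>splits b. f b * g c) * h c)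
        = (\<lambda>a. \<Sum>(b, c)\<in>splits a. f b * (\<Sum>(b, c)\<in>splits c. g b * h c))"
    proof
      fix a
      have "(\<Sum>(b, c)\<in>splits a. (\<Sum>(b, c)\<in>splits b. f b * g c) * h c)
          = (\<Sum>p\<in>splits a. \<Sum>r\<in>splits (fst p). f (fst r) * g (snd r) * h (snd p))"
        by (simp add: case_prod_beta sum_distrib_right)
      also have "\<dots> = (\<Sum>(p, r)\<in>(SIGMA p:splits a. splits (fst p)).
          f (fst r) * g (snd r) * h (snd p))"
        by (rule sum.Sigma) auto
      also have "\<dots> = (\<Sum>(p, r)\<in>(SIGMA p:splits a. splits (snd p)).
          f (fst p) * (g (fst r) * h (snd r)))"
        by (rule sum.reindex_bij_witness
              [where j = "\<lambda>(p, r). ((fst r, snd r + snd p), (snd r, snd p))"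
                 and i = "\<lambda>(p, r). ((fst p + fst r, snd r), (fst p, fst r))"])
          (auto simp: splits_def algebra_simps)
      also have "\<dots> = (\<Sum>p\<in>splits a. \<Sum>r\<in>splits (snd p). f (fst p) * (g (fst r) * h (snd r)))"
        by (rule sum.Sigma[symmetric]) auto
      also have "\<dots> = (\<Sum>(b, c)\<in>splits a. f b * (\<Sum>(b, c)\<in>splits c. g b * h c))"
        by (simp add: case_prod_beta sum_distrib_left)
      finally show "(\<Sum>(b, c)\<in>splits a. (\<Sum>(b, c)\<in>splits b. f b * g c) * h c)
          = (\<Sum>(b, c)\<in>splits a. f b * (\<Sum>(b, c)\<in>splits c. g b * h c))" .
    qed
  qed
  show "f * g = g * f"
  proof (transfer, rule ext)
    fix f g :: "monom_exp \<Rightarrow> 'a" and a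
    show "(\<Sum>(b, c)\<in>splits a. f b * g c) = (\<Sum>(b, c)\<in>splits a. g b * f c)"
      by (rule sum.reindex_bij_witness[where i = prod.swap and j = prod.swap])
        (auto simp: splits_def algebra_simps)
  qed
  show "1 * f = f"
  proof (transfer, rule ext)
    fix f :: "monom_exp \<Rightarrow> 'a" and a
    have "(\<Sum>(b, c)\<in>splits a. (if b = 0 then 1 else 0) * f c)
        = (\<Sum>(b, c)\<in>{(0 :: monom_exp, a)}. (if b = 0 then 1 else 0) * f c)"
      by (rule sum.mono_neutral_right, simp) (auto simp: splits_def split: if_splits)
    then show "(\<Sum>(b, c)\<in>splits a. (if b = 0 then 1 else 0) * f c) = f a" by simp
  qed
  show "(f + g) * h = f * h + g * h"
    by transfer (simp add: case_prod_beta algebra_simps sum.distrib)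
qed

end

lift_definition sf_scale :: "'a :: comm_ring_1 \<Rightarrow> 'a symfun \<Rightarrow> 'a symfun" is "\<lambda>c f a. c * f a"
proof (elim conjE exE, intro conjI)
  fix c :: 'a and f :: "monom_exp \<Rightarrow> 'a" and d
  assume "\<forall>a. f a \<noteq> 0 \<longrightarrow> mdeg a \<le> d"
  then show "\<exists>d. \<forall>a. c * f a \<noteq> 0 \<longrightarrow> mdeg a \<le> d"
    by (intro exI[of _ d]) (metis mult_zero_right)
qed auto

text \<open>The sum of all products of \<open>n\<close> distinct variables.\<close>

lift_definition elem_sym :: "nat \<Rightarrow> 'a :: comm_ring_1 symfun" is
  "\<lambda>n a. if card (Poly_Mapping.keys a) = n \<and> (\<forall>i. Poly_Mapping.lookup a i \<le> 1) then 1 else 0"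
proof (intro conjI allI impI)
  fix n :: nat and \<sigma> :: "nat \<Rightarrow> nat" and a :: monom_exp
  assume \<sigma>: "bij \<sigma>"
  let ?m = "Poly_Mapping.map_key \<sigma> a"
  have "card (Poly_Mapping.keys ?m) = card (Poly_Mapping.keys a)"
    using arg_cong[OF exponents_map_key[OF \<sigma>, of a], of size] by (simp add: exponents_def)
  moreover have "(\<forall>i. Poly_Mapping.lookup ?m i \<le> 1) \<longleftrightarrow> (\<forall>i. Poly_Mapping.lookup a i \<le> 1)"
    using bij_is_surj[OF \<sigma>] by (auto simp: map_key.rep_eq bij_is_inj[OF \<sigma>]) (metis surjD)
  ultimately show "(if card (Poly_Mapping.keys ?m) = n \<and> (\<forall>i. Poly_Mapping.lookup ?m i \<le> 1)
        then 1 else 0)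
      = (if card (Poly_Mapping.keys a) = n \<and> (\<forall>i. Poly_Mapping.lookup a i \<le> 1)
        then 1 else (0 :: 'a))"
    by simp
next
  fix n :: nat
  show "\<exists>d. \<forall>a. (if card (Poly_Mapping.keys a) = n \<and> (\<forall>i. Poly_Mapping.lookup a i \<le> 1)
      then 1 else (0 :: 'a)) \<noteq> 0 \<longrightarrow> mdeg a \<le> d"
  proof (intro exI[of _ n] allI impI)
    fix a :: monom_exp
    assume "(if card (Poly_Mapping.keys a) = n \<and> (\<forall>i. Poly_Mapping.lookup a i \<le> 1)
      then 1 else (0 :: 'a)) \<noteq> 0"
    then have *: "card (Poly_Mapping.keys a) = n" "\<And>i. Poly_Mapping.lookup a i \<le> 1"
      by (auto split: if_splits)
    have "mdeg a \<le> (\<Sum>i\<in>Poly_Mapping.keys a. 1)"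
      unfolding mdeg_def by (intro sum_mono *)
    with * show "mdeg a \<le> n" by simp
  qed
qed

text \<open>
  The sum of all distinct monomials whose nonzero exponents, rearranged, form the partition
  \<open>\<mu>\<close>.
\<close>

lift_definition mono_sym :: "nat list \<Rightarrow> 'a :: comm_ring_1 symfun" is
  "\<lambda>\<mu> a. if exponents a = mset \<mu> then 1 else 0"
proof (intro conjI)
  fix \<mu> :: "nat list"
  show "\<exists>d. \<forall>a. (if exponents a = mset \<mu> then 1 else (0 :: 'a)) \<noteq> 0 \<longrightarrow> mdeg a \<le> d"
    by (intro exI[of _ "sum_list \<mu>"]) (auto simp: mdeg_conv_exponents sum_mset_sum_list)
qed (auto simp: exponents_map_key)

text \<open>Homomorphisms of unital algebras from the symmetric functions to their coefficient ring.\<close>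

definition sf_algebra_hom :: "('a :: comm_ring_1 symfun \<Rightarrow> 'a) \<Rightarrow> bool" where
  "sf_algebra_hom \<phi> \<longleftrightarrow>
     \<phi> 1 = 1 \<and>
     (\<forall>f g. \<phi> (f + g) = \<phi> f + \<phi> g) \<and>
     (\<forall>f g. \<phi> (f * g) = \<phi> f * \<phi> g) \<and>
     (\<forall>c f. \<phi> (sf_scale c f) = c * \<phi> f)"


section \<open>Partitions\<close>

definition is_partition :: "nat list \<Rightarrow> bool" where
  "is_partition \<mu> \<longleftrightarrow> sorted_wrt (\<ge>) \<mu> \<and> (\<forall>i\<in>set \<mu>. 0 < i)"

text \<open>List positions start at 0, so the weight \<open>i - 1\<close> of the \<open>i\<close>-th part becomes \<open>i\<close>.\<close>

definition part_n :: "nat list \<Rightarrow> nat" where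
  "part_n \<mu> = (\<Sum>i<length \<mu>. i * \<mu> ! i)"

definition mult_fact :: "nat list \<Rightarrow> nat" where
  "mult_fact \<mu> = (\<Prod>i\<in>set \<mu>. fact (count_list \<mu> i))"


section \<open>The specialization\<close>

type_synonym ratfun = "rat poly fract"

definition q :: ratfun where
  "q = to_fract [:0, 1:]"

definition is_specialization :: "(ratfun symfun \<Rightarrow> ratfun) \<Rightarrow> bool" where
  "is_specialization \<phi> \<longleftrightarrow>
     sf_algebra_hom \<phi> \<and> (\<forall>n. \<phi> (elem_sym n) = q ^ (n choose 2) / of_nat (fact n))"

text \<open>
  The polynomials \<open>M\<^sub>\<mu>\<close> and \<open>J\<^sub>n\<close> are given by their characterizing equations. A solution is unique,
  since \<open>1 - q\<close> is invertible in the field of rational functions, but its existence is not evident: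
  an equation stated for \<open>M_poly\<close> or \<open>J_poly\<close> with the same factors asserts it. Division
  by \<open>q ^ part_n \<mu>\<close> takes place among the rational functions.
\<close>

definition M_poly :: "(ratfun symfun \<Rightarrow> ratfun) \<Rightarrow> nat list \<Rightarrow> rat poly" where
  "M_poly \<phi> \<mu> = (THE M. of_nat (mult_fact \<mu>) * \<phi> (mono_sym \<mu>)
     = (1 - q) ^ (sum_list \<mu> - length \<mu>) * to_fract M)"

definition J_part :: "(ratfun symfun \<Rightarrow> ratfun) \<Rightarrow> nat list \<Rightarrow> ratfun" where
  "J_part \<phi> \<mu> = of_nat (fact (sum_list \<mu> - 1)) * to_fract (M_poly \<phi> \<mu>) / q ^ part_n \<mu>"

definition J_poly :: "(ratfun symfun \<Rightarrow> ratfun) \<Rightarrow> nat \<Rightarrow> rat poly" where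
  "J_poly \<phi> n = (THE J. \<phi> (mono_sym [n])
     = (1 - q) ^ (n - 1) / of_nat (fact (n - 1)) * to_fract J)"

end

theory Submission
  imports Defs "HOL-Combinatorics.Permutations"
begin

text \<open>
  The augmented monomials \<open>m(\<mu>)! m\<^sub>\<mu>\<close> satisfy a product rule with power sums: multiplying by \<open>p\<^sub>a\<close>
  either adds a new part \<open>a\<close> or increases an old part by \<open>a\<close>. Solving for the former expresses all
  of them, by induction on the length, through the \<open>p\<^sub>n\<close>. Newton's identities and the functional
  equation \<open>E'(t) = E(q t)\<close> of \<open>E = \<Sum> q\<^bsup>n(n-1)/2\<^esup> t\<^sup>n / n!\<close> give a quadratic recurrence that shows
  \<open>(n - 1)! p\<^sub>n = (1 - q)\<^bsup>n-1\<^esup> J\<^sub>n\<close> with \<open>J\<^sub>n\<close> monic over \<open>\<int>\<close>. Divisibility by the power of \<open>1 - q\<close>,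
  integrality and the degree are inherited from the \<open>J\<^sub>n\<close> along the induction.

  For the order, \<open>2 n(\<mu>) + |\<mu>| = \<Sum>\<^sub>i\<^sub>,\<^sub>j min(\<mu>\<^sub>i, \<mu>\<^sub>j)\<close> is superadditive on exponent vectors. Hence if \<open>\<nu>\<close>
  is \<open>\<mu>\<close> without its first column, of length \<open>l\<close>, then \<open>e\<^sub>l m\<^sub>\<nu>\<close> is \<open>m\<^sub>\<mu>\<close> plus monomial functions with
  larger \<open>n\<close>, and descending induction on \<open>n\<close> reads off the lowest power of \<open>q\<close>.
\<close>

section \<open>Augmented monomial symmetric functions\<close>

fun place :: "nat list \<Rightarrow> nat list \<Rightarrow> monom_exp" where
  "place (a # \<mu>) (x # xs) = Poly_Mapping.single x a + place \<mu> xs"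
| "place _ _ = 0"

text \<open>Equal parts are told apart by their position, so for positive parts each monomial of
  type \<mu> has m(\<mu>)! placements. This turns identities between augmented monomial functions
  into bijections.\<close>

definition placements :: "nat list \<Rightarrow> monom_exp \<Rightarrow> nat list set" where
  "placements \<mu> c = {xs. distinct xs \<and> length xs = length \<mu> \<and> place \<mu> xs = c}"

lemma lookup_place_notin: "x \<notin> set xs \<Longrightarrow> Poly_Mapping.lookup (place \<mu> xs) x = 0"
  by (induction \<mu> xs rule: place.induct) (auto simp: lookup_add lookup_single)

lemma map_lookup_place:
  "length xs = length \<mu> \<Longrightarrow> distinct xs \<Longrightarrow> map (Poly_Mapping.lookup (place \<mu> xs)) xs = \<mu>"
proof (induction \<mu> xs rule: place.induct)
  case (1 a \<mu> x xs)
  have "map (\<lambda>y. Poly_Mapping.lookup (Poly_Mapping.single x a) y + Poly_Mapping.lookup (place \<mu> xs) y) xs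
      = map (Poly_Mapping.lookup (place \<mu> xs)) xs"
    using 1 by (intro map_cong refl) (auto simp: lookup_add lookup_single when_def)
  then show ?case using 1 by (simp add: lookup_add lookup_place_notin del: map_eq_conv)
qed auto

text \<open>When all parts are positive, the variables used are exactly the support of
  \<open>c\<close>, so a placement is an ordering of that support along which the exponents read
  \<mu>. In this form placements can be counted.\<close>

lemma placements_eq:
  assumes "0 \<notin> set \<mu>"
  shows "placements \<mu> c =
    {xs. distinct xs \<and> set xs = Poly_Mapping.keys c \<and> map (Poly_Mapping.lookup c) xs = \<mu>}"
proof (intro Collect_cong iffI set_eqI, unfold placements_def, safe)
  fix xs :: "nat list" and x assume *: "distinct xs" "length xs = length \<mu>"
  note map = map_lookup_place[OF *(2,1)]
  show "map (Poly_Mapping.lookup (place \<mu> xs)) xs = \<mu>" by (fact map)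
  show "x \<in> Poly_Mapping.keys (place \<mu> xs)" if "x \<in> set xs"
    using that assms map by (metis image_eqI in_keys_iff list.set_map)
  show "x \<in> set xs" if "x \<in> Poly_Mapping.keys (place \<mu> xs)"
    using that lookup_place_notin[of x xs \<mu>] by (auto simp: in_keys_iff)
next
  fix xs assume *: "distinct xs" "set xs = Poly_Mapping.keys c"
    and \<mu>: "\<mu> = map (Poly_Mapping.lookup c) xs"
  have "map (Poly_Mapping.lookup (place \<mu> xs)) xs = map (Poly_Mapping.lookup c) xs"
    using map_lookup_place[of xs \<mu>] * \<mu> by simp
  then have "Poly_Mapping.lookup (place \<mu> xs) x = Poly_Mapping.lookup c x" for x
    using * lookup_place_notin[of x xs \<mu>] by (cases "x \<in> set xs") (auto simp: in_keys_iff)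
  then show "place (map (Poly_Mapping.lookup c) xs) xs = c"
    unfolding \<mu> by (intro poly_mapping_eqI)
qed auto

lemma finite_placements [simp]:
  assumes "0 \<notin> set \<mu>"
  shows "finite (placements \<mu> c)"
proof (rule finite_subset[OF _ finite_lists_length_eq[of "Poly_Mapping.keys c" "length \<mu>"]])
  show "placements \<mu> c \<subseteq> {xs. set xs \<subseteq> Poly_Mapping.keys c \<and> length xs = length \<mu>}"
    unfolding placements_eq[OF assms] by auto
qed simp

lemma mult_fact_conv_prod:
  assumes "finite A" "set \<mu> \<subseteq> A"
  shows "mult_fact \<mu> = (\<Prod>i\<in>A. fact (count_list \<mu> i))"
  unfolding mult_fact_def using assms
  by (intro prod.mono_neutral_left) (auto simp: count_list_0_iff)

lemma mult_fact_Nil [simp]: "mult_fact [] = 1"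
  by (simp add: mult_fact_def)

lemma mult_fact_Cons: "mult_fact (a # \<mu>) = Suc (count_list \<mu> a) * mult_fact \<mu>"
proof -
  let ?A = "insert a (set \<mu>)"
  have "mult_fact (a # \<mu>) = (\<Prod>i\<in>?A. fact (count_list (a # \<mu>) i))"
    by (intro mult_fact_conv_prod) auto
  also have "\<dots> = fact (Suc (count_list \<mu> a)) * (\<Prod>i\<in>?A - {a}. fact (count_list (a # \<mu>) i))"
    by (subst prod.remove[of _ a]) auto
  also have "(\<Prod>i\<in>?A - {a}. fact (count_list (a # \<mu>) i)) = (\<Prod>i\<in>?A - {a}. fact (count_list \<mu> i) :: nat)"
    by (intro prod.cong) auto
  also have "fact (Suc (count_list \<mu> a)) * \<dots> = Suc (count_list \<mu> a) * (\<Prod>i\<in>?A. fact (count_list \<mu> i))"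
    by (subst (2) prod.remove[of _ a]) (auto simp: algebra_simps)
  also have "(\<Prod>i\<in>?A. fact (count_list \<mu> i)) = mult_fact \<mu>"
    by (intro mult_fact_conv_prod[symmetric]) auto
  finally show ?thesis .
qed

lemma mult_fact_mset_cong: "mset \<mu> = mset \<nu> \<Longrightarrow> mult_fact \<mu> = mult_fact \<nu>"
  unfolding mult_fact_def count_mset[symmetric] by (metis set_mset_mset)

lemma mult_fact_pos: "mult_fact \<mu> > 0"
  by (simp add: mult_fact_def)

lemma mult_fact_replicate [simp]: "mult_fact (replicate n a) = fact n"
proof (induction n)
  case (Suc n)
  have "count_list (replicate n a) a = n" by (induction n) auto
  with Suc show ?case by (simp add: mult_fact_Cons)
qed simp

text \<open>Peel off the first entry: it is any element of \<open>A\<close> with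
  \<open>f\<close>-value \<open>a\<close>. If the multisets agree there are
  \<open>Suc (count_list \<mu> a)\<close> of them, the factor by which \<open>mult_fact\<close>
  grows under \<open>Cons\<close>.\<close>

lemma card_enumerations:
  assumes "finite A"
  shows "card {xs. distinct xs \<and> set xs = A \<and> map f xs = \<mu>}
    = (if image_mset f (mset_set A) = mset \<mu> then mult_fact \<mu> else 0)"
  using assms
proof (induction \<mu> arbitrary: A)
  case Nil
  have "{xs. distinct xs \<and> set xs = A \<and> map f xs = []} = (if A = {} then {[]} else {})"
    by auto
  with Nil show ?case by (auto simp: mset_set_empty_iff)
next
  case (Cons a \<mu>)
  let ?E = "\<lambda>A \<mu>. {xs. distinct xs \<and> set xs = A \<and> map f xs = \<mu>}"
  let ?I = "{i\<in>A. f i = a}"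
  have fin: "finite (?E A \<mu>)" if "finite A" for A \<mu>
  proof (rule finite_subset[OF _ finite_lists_length_eq[OF that, of "card A"]])
    show "?E A \<mu> \<subseteq> {xs. set xs \<subseteq> A \<and> length xs = card A}"
      by (auto simp: distinct_card)
  qed
  have "?E A (a # \<mu>) = (\<Union>i\<in>?I. (#) i ` ?E (A - {i}) \<mu>)" (is "_ = ?R")
  proof (intro set_eqI iffI)
    fix xs assume "xs \<in> ?E A (a # \<mu>)"
    moreover from this obtain i ys where "xs = i # ys" by (cases xs) auto
    ultimately show "xs \<in> ?R" by auto
  next
    fix xs assume "xs \<in> ?R"
    then show "xs \<in> ?E A (a # \<mu>)" by fastforce
  qed
  then have "card (?E A (a # \<mu>)) = (\<Sum>i\<in>?I. card ((#) i ` ?E (A - {i}) \<mu>))"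
    using Cons.prems fin by (simp only:) (intro card_UN_disjoint, auto)
  also have "\<dots> = (\<Sum>i\<in>?I. card (?E (A - {i}) \<mu>))"
    by (intro sum.cong refl card_image) auto
  also have "\<dots> = (\<Sum>i\<in>?I. if image_mset f (mset_set A) = mset (a # \<mu>) then mult_fact \<mu> else 0)"
  proof (intro sum.cong refl)
    fix i assume i: "i \<in> ?I"
    have "mset_set A = add_mset i (mset_set (A - {i}))"
      using i Cons.prems by (simp add: mset_set.remove)
    then have "image_mset f (mset_set (A - {i})) = mset \<mu>
        \<longleftrightarrow> image_mset f (mset_set A) = mset (a # \<mu>)"
      using i by simp
    then show "card (?E (A - {i}) \<mu>)
        = (if image_mset f (mset_set A) = mset (a # \<mu>) then mult_fact \<mu> else 0)"
      using Cons.IH[of "A - {i}"] Cons.prems by simp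
  qed
  also have "\<dots> = (if image_mset f (mset_set A) = mset (a # \<mu>) then mult_fact (a # \<mu>) else 0)"
  proof (cases "image_mset f (mset_set A) = mset (a # \<mu>)")
    case True
    have "card ?I = count (image_mset f (mset_set A)) a"
      using Cons.prems by (simp add: count_image_mset Collect_conj_eq vimage_def Int_commute)
    also have "\<dots> = Suc (count_list \<mu> a)" unfolding True by (simp add: count_mset)
    finally show ?thesis using True by (simp add: mult_fact_Cons)
  qed simp
  finally show ?case .
qed

lemma card_placements:
  assumes "0 \<notin> set \<mu>"
  shows "card (placements \<mu> c) = (if exponents c = mset \<mu> then mult_fact \<mu> else 0)"
  unfolding placements_eq[OF assms] exponents_def by (rule card_enumerations) simp

section \<open>The product rule with power sums\<close>

definition aug_mono_sym :: "nat list \<Rightarrow> 'a :: comm_ring_1 symfun" where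
  "aug_mono_sym \<mu> = sf_scale (of_nat (mult_fact \<mu>)) (mono_sym \<mu>)"

lemma sf_coeff_aug_mono_sym:
  assumes "0 \<notin> set \<mu>"
  shows "sf_coeff (aug_mono_sym \<mu>) c = of_nat (card (placements \<mu> c))"
  by (simp add: aug_mono_sym_def sf_scale.rep_eq mono_sym.rep_eq card_placements[OF assms])

lemma sf_eqI: "(\<And>a. sf_coeff f a = sf_coeff g a) \<Longrightarrow> f = g"
  by (metis ext sf_coeff_inject)

lemma sf_coeff_sum: "sf_coeff (sum f A) a = (\<Sum>x\<in>A. sf_coeff (f x) a)"
  by (induction A rule: infinite_finite_induct) (auto simp: zero_symfun.rep_eq plus_symfun.rep_eq)

lemma sf_coeff_aug_mono_sym_mult:
  assumes "0 \<notin> set \<kappa>" "0 \<notin> set \<mu>"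
  shows "sf_coeff (aug_mono_sym \<kappa> * aug_mono_sym \<mu>) c
    = of_nat (card (SIGMA p:splits c. placements \<kappa> (fst p) \<times> placements \<mu> (snd p)))"
  using assms
  by (simp add: times_symfun.rep_eq sf_coeff_aug_mono_sym case_prod_beta card_SigmaI card_cartesian_product)

lemma place_list_update:
  "length xs = length \<mu> \<Longrightarrow> j < length \<mu> \<Longrightarrow>
    place (\<mu>[j := \<mu> ! j + a]) xs = Poly_Mapping.single (xs ! j) a + place \<mu> xs"
proof (induction \<mu> xs arbitrary: j rule: place.induct)
  case (1 b \<mu> x xs)
  then show ?case
    by (cases j) (auto simp: single_add algebra_simps)
qed auto

text \<open>The new part \<open>a\<close> is either placed on a fresh variable, or on the variable of an old part.\<close>

lemma aug_mono_sym_mult_single: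
  assumes "0 \<notin> set \<mu>" "0 < a"
  shows "(aug_mono_sym [a] * aug_mono_sym \<mu> :: 'a :: comm_ring_1 symfun)
    = aug_mono_sym (a # \<mu>) + (\<Sum>j<length \<mu>. aug_mono_sym (\<mu>[j := \<mu> ! j + a]))"
proof (rule sf_eqI)
  fix c
  let ?S = "SIGMA p:splits c. placements [a] (fst p) \<times> placements \<mu> (snd p)"
  let ?T = "SIGMA j:{..<length \<mu>}. placements (\<mu>[j := \<mu> ! j + a]) c"
  define old where "old = {(p, ys, xs). (p, ys, xs) \<in> ?S \<and> hd ys \<in> set xs}"
  define new where "new = {(p, ys, xs). (p, ys, xs) \<in> ?S \<and> hd ys \<notin> set xs}"
  have pos: "0 \<notin> set (\<mu>[j := \<mu> ! j + a])" for j
    using assms set_update_subset_insert[of \<mu> j "\<mu> ! j + a"] by auto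
  have S: "?S = new \<union> old" "new \<inter> old = {}" by (auto simp: old_def new_def)
  have "finite ?S" using assms by auto
  then have "card ?S = card new + card old"
    using S by (metis card_Un_disjoint finite_Un)
  also have "card new = card (placements (a # \<mu>) c)"
    by (rule bij_betw_same_card[of "\<lambda>(p, ys, xs). hd ys # xs"],
        rule bij_betw_byWitness[where f' = "\<lambda>zs. ((Poly_Mapping.single (hd zs) a, place \<mu> (tl zs)), [hd zs], tl zs)"])
      (auto simp: new_def placements_def splits_def length_Suc_conv)
  \<comment> \<open>A shared variable sits at exactly one position \<open>j\<close> of the distinct
    list \<open>xs\<close>; there the two exponents add up.\<close>
  also have "card old = card ?T"
  proof (rule bij_betw_same_card[symmetric, of "\<lambda>(j, xs). ((Poly_Mapping.single (xs ! j) a, place \<mu> xs), [xs ! j], xs)"],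
      rule bij_betw_imageI)
    show "inj_on (\<lambda>(j, xs). ((Poly_Mapping.single (xs ! j) a, place \<mu> xs), [xs ! j], xs)) ?T"
      by (auto simp: inj_on_def placements_def nth_eq_iff_index_eq)
    show "(\<lambda>(j, xs). ((Poly_Mapping.single (xs ! j) a, place \<mu> xs), [xs ! j], xs)) ` ?T = old"
    proof (intro set_eqI iffI)
      fix z assume "z \<in> old"
      then obtain b d x xs where z: "z = ((b, d), [x], xs)" and x: "x \<in> set xs"
        and *: "distinct xs" "length xs = length \<mu>" "d = place \<mu> xs" "b = Poly_Mapping.single x a"
          "b + d = c"
        by (auto simp: old_def placements_def splits_def length_Suc_conv)
      from x obtain j where j: "j < length xs" "x = xs ! j" by (metis in_set_conv_nth)
      with * have "(j, xs) \<in> ?T"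
        by (auto simp: placements_def place_list_update)
      then show "z \<in> (\<lambda>(j, xs). ((Poly_Mapping.single (xs ! j) a, place \<mu> xs), [xs ! j], xs)) ` ?T"
        by (rule rev_image_eqI) (simp add: z * j)
    qed (auto simp: old_def placements_def splits_def place_list_update)
  qed
  also have "card ?T = (\<Sum>j<length \<mu>. card (placements (\<mu>[j := \<mu> ! j + a]) c))"
    using pos by simp
  finally show "sf_coeff (aug_mono_sym [a] * aug_mono_sym \<mu> :: 'a symfun) c = sf_coeff (aug_mono_sym (a # \<mu>)
      + (\<Sum>j<length \<mu>. aug_mono_sym (\<mu>[j := \<mu> ! j + a]))) c"
    using assms pos
    by (subst sf_coeff_aug_mono_sym_mult)
      (auto simp: plus_symfun.rep_eq sf_coeff_sum sf_coeff_aug_mono_sym)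
qed

lemma exponents_eq_ones_iff:
  "exponents a = mset (replicate n 1) \<longleftrightarrow>
    card (Poly_Mapping.keys a) = n \<and> (\<forall>i. Poly_Mapping.lookup a i \<le> 1)"
proof
  assume *: "exponents a = mset (replicate n 1)"
  have "card (Poly_Mapping.keys a) = n"
    using arg_cong[OF *, of size] by (simp add: exponents_def)
  moreover have "Poly_Mapping.lookup a i \<le> 1" for i
  proof (cases "i \<in> Poly_Mapping.keys a")
    case True
    then have "Poly_Mapping.lookup a i \<in># exponents a" by (simp add: exponents_def)
    then show ?thesis unfolding * by (auto split: if_splits)
  qed (simp add: in_keys_iff)
  ultimately show "card (Poly_Mapping.keys a) = n \<and> (\<forall>i. Poly_Mapping.lookup a i \<le> 1)" by blast
next
  assume *: "card (Poly_Mapping.keys a) = n \<and> (\<forall>i. Poly_Mapping.lookup a i \<le> 1)"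
  have "exponents a = image_mset (\<lambda>_. 1) (mset_set (Poly_Mapping.keys a))"
    unfolding exponents_def
  proof (intro image_mset_cong)
    fix x assume "x \<in># mset_set (Poly_Mapping.keys a)"
    then show "Poly_Mapping.lookup a x = 1" using *[THEN conjunct2, rule_format, of x]
      by (auto simp: in_keys_iff)
  qed
  then show "exponents a = mset (replicate n 1)"
    using * by (simp add: image_mset_const_eq)
qed

lemma elem_sym_conv_mono_sym: "elem_sym n = mono_sym (replicate n 1)"
  by (rule sf_eqI) (simp only: elem_sym.rep_eq mono_sym.rep_eq exponents_eq_ones_iff)

lemma mono_sym_mset_cong: "mset \<mu> = mset \<nu> \<Longrightarrow> mono_sym \<mu> = mono_sym \<nu>"
  by (rule sf_eqI) (simp add: mono_sym.rep_eq)

lemma aug_mono_sym_mset_cong: "mset \<mu> = mset \<nu> \<Longrightarrow> aug_mono_sym \<mu> = aug_mono_sym \<nu>"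
  unfolding aug_mono_sym_def using mono_sym_mset_cong mult_fact_mset_cong by metis

section \<open>Power sums and one-part partitions\<close>

text \<open>Characteristic zero makes all factorials invertible among the rational
  functions.\<close>

instance fract :: ("{idom, ring_char_0}") ring_char_0
proof
  have "(of_nat n :: 'a fract) = to_fract (of_nat n)" for n by (induction n) auto
  then show "inj (of_nat :: nat \<Rightarrow> 'a fract)" by (auto intro: injI)
qed

definition of_int_poly :: "int poly \<Rightarrow> rat poly" where
  "of_int_poly p = map_poly rat_of_int p"

lemma coeff_of_int_poly [simp]: "coeff (of_int_poly p) n = of_int (coeff p n)"
  by (simp add: of_int_poly_def coeff_map_poly)

lemma of_int_poly_simps [simp]:
  "of_int_poly 0 = 0" "of_int_poly 1 = 1"
  "of_int_poly (p + p') = of_int_poly p + of_int_poly p'"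
  "of_int_poly (p * p') = of_int_poly p * of_int_poly p'"
  by (simp_all add: poly_eq_iff coeff_mult)

lemma of_int_poly_sum [simp]: "of_int_poly (sum f A) = (\<Sum>x\<in>A. of_int_poly (f x))"
  by (induction A rule: infinite_finite_induct) auto

lemma of_int_poly_of_nat [simp]: "of_int_poly (of_nat n) = of_nat n"
  by (induction n) auto

lemma of_int_poly_pCons [simp]: "of_int_poly (pCons c p) = pCons (of_int c) (of_int_poly p)"
  by (simp add: poly_eq_iff coeff_pCons split: nat.split)

lemma of_int_poly_power [simp]: "of_int_poly (p ^ n) = of_int_poly p ^ n"
  by (induction n) auto

lemma to_fract_power [simp]: "to_fract (x ^ n) = to_fract x ^ n"
  by (induction n) auto

lemma to_fract_of_nat [simp]: "to_fract (of_nat n) = of_nat n"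
  by (induction n) auto

abbreviation int_frac :: "int poly \<Rightarrow> ratfun" where
  "int_frac p \<equiv> to_fract (of_int_poly p)"

lemma int_frac_X_minus_1 [simp]: "int_frac [:-1, 1:] = q - 1"
  by (simp add: q_def one_pCons flip: to_fract_1 to_fract_diff)

text \<open>Shifted index: \<open>tree_inv n\<close> is \<open>J\<^sub>n\<^sub>+\<^sub>1\<close>.\<close>

fun tree_inv :: "nat \<Rightarrow> int poly" where
  "tree_inv 0 = 1"
| "tree_inv (Suc n) = (\<Sum>i\<le>n. of_nat (n choose i) * tree_inv i * tree_inv (n - i)
    * (\<Sum>k\<le>n - i. [:0, 1:] ^ k))"

declare tree_inv.simps(2) [simp del]

section \<open>Newton's identities under the specialization\<close>

context
  fixes \<phi> :: "ratfun symfun \<Rightarrow> ratfun"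
  assumes spec: "is_specialization \<phi>"
begin

lemma \<phi>_add: "\<phi> (f + g) = \<phi> f + \<phi> g"
  and \<phi>_mult: "\<phi> (f * g) = \<phi> f * \<phi> g"
  and \<phi>_scale: "\<phi> (sf_scale c f) = c * \<phi> f"
  and \<phi>_elem_sym: "\<phi> (elem_sym n) = q ^ (n choose 2) / of_nat (fact n)"
  using spec by (auto simp: is_specialization_def sf_algebra_hom_def)

lemma \<phi>_0: "\<phi> 0 = 0"
  using \<phi>_add[of 0 0] by simp

lemma \<phi>_diff: "\<phi> (f - g) = \<phi> f - \<phi> g"
  using \<phi>_add[of "f - g" g] by simp

lemma \<phi>_sum: "\<phi> (sum f A) = (\<Sum>x\<in>A. \<phi> (f x))"
  by (induction A rule: infinite_finite_induct) (auto simp: \<phi>_0 \<phi>_add)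

definition aug_val :: "nat list \<Rightarrow> ratfun" where
  "aug_val \<mu> = \<phi> (aug_mono_sym \<mu>)"

lemma aug_val_eq: "aug_val \<mu> = of_nat (mult_fact \<mu>) * \<phi> (mono_sym \<mu>)"
  by (simp add: aug_val_def aug_mono_sym_def \<phi>_scale)

lemma aug_val_mset_cong: "mset \<mu> = mset \<nu> \<Longrightarrow> aug_val \<mu> = aug_val \<nu>"
  unfolding aug_val_def using aug_mono_sym_mset_cong by metis

lemma aug_val_ones: "aug_val (replicate n 1) = q ^ (n choose 2)"
  using \<phi>_elem_sym[of n] by (simp add: aug_val_eq elem_sym_conv_mono_sym)

lemma aug_val_mult_single:
  assumes "0 \<notin> set \<mu>" "0 < a"
  shows "aug_val [a] * aug_val \<mu> = aug_val (a # \<mu>) + (\<Sum>j<length \<mu>. aug_val (\<mu>[j := \<mu> ! j + a]))"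
  using arg_cong[OF aug_mono_sym_mult_single[OF assms], of \<phi>]
  by (simp add: aug_val_def \<phi>_mult \<phi>_add \<phi>_sum)

definition elem_val :: "nat \<Rightarrow> ratfun" where
  "elem_val n = q ^ (n choose 2) / fact n"

lemma elem_val_0 [simp]: "elem_val 0 = 1"
  by (simp add: elem_val_def numeral_2_eq_2)

text \<open>For \<open>r \<ge> 2\<close> this is the value of m_(r, 1^k). For \<open>r = 1\<close>
  the denominator falls short of m(\<mu>)! = (k + 1)! and the value is (k + 1) e_(k+1), the
  right-hand side of Newton's identity.\<close>

definition hook_val :: "nat \<Rightarrow> nat \<Rightarrow> ratfun" where
  "hook_val r k = aug_val (r # replicate k 1) / fact k"

text \<open>The product rule for the column 1^(k+1): raising any one of its k + 1 ones gives the
  same hook, and this multiplicity reduces the denominator (k + 1)! to k!.\<close>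

lemma power_sum_mult_elem:
  assumes "0 < r"
  shows "aug_val [r] * elem_val (Suc k) = hook_val r (Suc k) + hook_val (Suc r) k"
proof -
  let ?o = "replicate (Suc k) (1 :: nat)"
  have "aug_val (?o[j := ?o ! j + r]) = aug_val (Suc r # replicate k 1)" if "j < Suc k" for j
  proof (rule aug_val_mset_cong)
    have "?o ! j = 1" using that by (simp del: replicate_Suc)
    moreover have "mset (?o[j := ?o ! j + r]) = add_mset (?o ! j + r) (mset ?o - {#?o ! j#})"
      using that by (intro mset_update) simp
    ultimately show "mset (?o[j := ?o ! j + r]) = mset (Suc r # replicate k 1)" by simp
  qed
  then have "(\<Sum>j<Suc k. aug_val (?o[j := ?o ! j + r])) = of_nat (Suc k) * aug_val (Suc r # replicate k 1)"
    by (simp del: replicate_Suc of_nat_Suc sum.lessThan_Suc)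
  then have "aug_val [r] * aug_val ?o = aug_val (r # ?o) + of_nat (Suc k) * aug_val (Suc r # replicate k 1)"
    using aug_val_mult_single[of ?o r] assms by (simp del: replicate_Suc of_nat_Suc sum.lessThan_Suc)
  then show ?thesis
    unfolding aug_val_ones elem_val_def hook_val_def using of_nat_neq_0[of k, where 'a = ratfun]
    by (simp add: add_divide_distrib del: replicate_Suc of_nat_Suc)
qed

text \<open>Each product splits by \<open>power_sum_mult_elem\<close> into two adjacent hooks; in
  the alternating sum all cancel except the first one.\<close>

lemma power_sum_elem_telescope:
  "0 < r \<Longrightarrow> (\<Sum>j\<le>n. (-1) ^ j * aug_val [r + j] * elem_val (n - j)) = hook_val r n"
proof (induction n arbitrary: r)
  case 0
  then show ?case by (simp add: hook_val_def)
next
  case (Suc n)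
  have "(\<Sum>j\<le>Suc n. (-1) ^ j * aug_val [r + j] * elem_val (Suc n - j))
      = aug_val [r] * elem_val (Suc n) - (\<Sum>j\<le>n. (-1) ^ j * aug_val [Suc r + j] * elem_val (n - j))"
    by (subst sum.atMost_Suc_shift) (simp add: sum_negf)
  also have "\<dots> = hook_val r (Suc n)"
    unfolding Suc.IH[OF zero_less_Suc] using power_sum_mult_elem[OF Suc.prems, of n] by simp
  finally show ?case .
qed

lemma newton_identity:
  "(\<Sum>j\<le>n. (-1) ^ j * aug_val [Suc j] * elem_val (n - j)) = of_nat (Suc n) * elem_val (Suc n)"
proof -
  have "hook_val 1 n = of_nat (Suc n) * elem_val (Suc n)"
    using aug_val_ones[of "Suc n"] of_nat_neq_0[of n, where 'a = ratfun]
    by (simp add: hook_val_def elem_val_def del: of_nat_Suc)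
  then show ?thesis using power_sum_elem_telescope[of 1 n] by simp
qed

section \<open>The logarithmic derivative of the generating series of the e_n\<close>

definition power_sum_series :: "ratfun fps" where
  "power_sum_series = Abs_fps (\<lambda>j. (-1) ^ j * aug_val [Suc j])"

definition dilate :: "ratfun fps \<Rightarrow> ratfun fps" where
  "dilate f = Abs_fps (\<lambda>n. q ^ n * fps_nth f n)"

lemma dilate_mult: "dilate (f * g) = dilate f * dilate g"
proof (rule fps_ext)
  fix n
  have "q ^ n * (\<Sum>i=0..n. fps_nth f i * fps_nth g (n - i))
      = (\<Sum>i=0..n. q ^ i * fps_nth f i * (q ^ (n - i) * fps_nth g (n - i)))"
    unfolding sum_distrib_left
  proof (intro sum.cong refl)
    fix i assume "i \<in> {0..n}"
    then have "q ^ n = q ^ i * q ^ (n - i)" by (simp flip: power_add)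
    then show "q ^ n * (fps_nth f i * fps_nth g (n - i))
        = q ^ i * fps_nth f i * (q ^ (n - i) * fps_nth g (n - i))" by simp
  qed
  then show "fps_nth (dilate (f * g)) n = fps_nth (dilate f * dilate g) n"
    by (simp add: dilate_def fps_mult_nth)
qed

lemma fps_deriv_dilate: "fps_deriv (dilate f) = fps_const q * dilate (fps_deriv f)"
  by (rule fps_ext) (simp add: dilate_def)

text \<open>
  With \<open>E = \<Sum> e\<^sub>n t\<^sup>n\<close> the specialization amounts to \<open>E'(t) = E(q t)\<close>, and Newton's identities
  say \<open>E' = U E\<close>. Differentiating \<open>U(t) E(t) = E(q t)\<close> eliminates \<open>E\<close>.
\<close>

lemma fps_deriv_power_sum_series:
  "fps_deriv power_sum_series = power_sum_series * (fps_const q * dilate power_sum_series - power_sum_series)"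
proof -
  define E where "E = Abs_fps elem_val"
  let ?U = power_sum_series
  have UE: "?U * E = fps_deriv E"
  proof (rule fps_ext)
    fix n
    show "fps_nth (?U * E) n = fps_nth (fps_deriv E) n"
      using newton_identity[of n]
      by (simp add: E_def power_sum_series_def fps_mult_nth atMost_atLeast0)
  qed
  have E': "fps_deriv E = dilate E"
  proof (rule fps_ext)
    fix n
    have "Suc n choose 2 = (n choose 2) + n" by (simp add: numeral_2_eq_2)
    then have "of_nat (Suc n) * elem_val (Suc n) = q ^ n * elem_val n"
      using of_nat_neq_0[of n, where 'a = ratfun]
      by (simp add: elem_val_def power_add del: of_nat_Suc)
    then show "fps_nth (fps_deriv E) n = fps_nth (dilate E) n"
      by (simp add: E_def dilate_def)
  qed
  have "fps_deriv (?U * E) = fps_deriv (dilate E)" using UE E' by simp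
  then have "fps_deriv ?U * E + ?U * fps_deriv E = fps_const q * dilate (fps_deriv E)"
    by (simp add: fps_deriv_dilate algebra_simps)
  also have "dilate (fps_deriv E) = dilate ?U * dilate E"
    unfolding UE[symmetric] dilate_mult ..
  also have "dilate E = ?U * E" using UE E' by simp
  finally have "fps_deriv ?U * E = ?U * (fps_const q * dilate ?U - ?U) * E"
    unfolding UE[symmetric] by (simp add: algebra_simps)
  moreover have "E \<noteq> 0"
  proof
    assume "E = 0"
    then have "fps_nth E 0 = 0" by simp
    then show False by (simp add: E_def)
  qed
  ultimately show ?thesis by simp
qed

text \<open>Coefficients of t^n in the equation for U'. The factor q^(n-i+1) - 1 is the effect of q
  U(q t) - U(t) on the coefficient of t^(n-i); it is where the powers of q - 1 come from.\<close>

lemma aug_val_single_rec: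
  "of_nat (Suc n) * fps_nth power_sum_series (Suc n)
    = (\<Sum>i\<le>n. fps_nth power_sum_series i * fps_nth power_sum_series (n - i) * (q ^ Suc (n - i) - 1))"
proof -
  let ?U = power_sum_series
  have "of_nat (Suc n) * fps_nth ?U (Suc n)
      = fps_nth (?U * (fps_const q * dilate ?U - ?U)) n"
    unfolding fps_deriv_power_sum_series[symmetric] by simp
  also have "\<dots> = (\<Sum>i\<le>n. fps_nth ?U i * fps_nth (fps_const q * dilate ?U - ?U) (n - i))"
    unfolding atMost_atLeast0 by (rule fps_mult_nth)
  also have "\<dots> = (\<Sum>i\<le>n. fps_nth ?U i * fps_nth ?U (n - i) * (q ^ Suc (n - i) - 1))"
    by (simp add: dilate_def algebra_simps)
  finally show ?thesis .
qed

text \<open>The recurrence times m!, with n = m + 1: m! splits as C(m, i) i! (m - i)!, the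
  coefficients of index i and m - i contribute (q - 1)^m by induction, and q^(m-i+1) - 1 is q - 1
  times a geometric sum.\<close>

lemma power_sum_series_tree_inv:
  "fact n * fps_nth power_sum_series n = (q - 1) ^ n * int_frac (tree_inv n)"
proof (induction n rule: less_induct)
  case (less n)
  show ?case
  proof (cases n)
    case 0
    then show ?thesis using aug_val_ones[of 1] by (simp add: power_sum_series_def numeral_2_eq_2)
  next
    case (Suc m)
    have *: "fact m * (fps_nth power_sum_series i * fps_nth power_sum_series (m - i) * (q ^ Suc (m - i) - 1))
      = (q - 1) ^ n * int_frac (of_nat (m choose i) * tree_inv i * tree_inv (m - i)
    * (\<Sum>k\<le>m - i. [:0, 1:] ^ k))" if "i \<le> m" for i
    proof -
      have f: "(fact m :: ratfun) = of_nat (m choose i) * fact i * fact (m - i)"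
        using binomial_fact_lemma[OF that]
        by (metis (no_types, lifting) mult.commute mult.left_commute of_nat_fact of_nat_mult)
      have g: "q ^ Suc (m - i) - 1 = (q - 1) * int_frac (\<Sum>k\<le>m - i. [:0, 1:] ^ k)"
        by (subst power_diff_1_eq) (simp add: lessThan_Suc_atMost q_def)
      have "fact m * (fps_nth power_sum_series i * fps_nth power_sum_series (m - i) * (q ^ Suc (m - i) - 1))
        = of_nat (m choose i) * (fact i * fps_nth power_sum_series i)
          * (fact (m - i) * fps_nth power_sum_series (m - i)) * (q ^ Suc (m - i) - 1)"
        unfolding f by (simp only: mult_ac)
      also have "\<dots> = of_nat (m choose i) * ((q - 1) ^ i * int_frac (tree_inv i))
        * ((q - 1) ^ (m - i) * int_frac (tree_inv (m - i)))
        * ((q - 1) * int_frac (\<Sum>k\<le>m - i. [:0, 1:] ^ k))"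
        unfolding g using that Suc by (subst (1 2) less.IH) auto
      also have "(q - 1) ^ n = (q - 1) * (q - 1) ^ i * (q - 1) ^ (m - i)"
        using that Suc by (simp flip: power_add)
      ultimately show ?thesis by (simp add: mult_ac)
    qed
    have "fact n * fps_nth power_sum_series n = fact m * (of_nat (Suc m) * fps_nth power_sum_series (Suc m))"
      unfolding Suc by (simp add: algebra_simps)
    also have "\<dots> = (\<Sum>i\<le>m. (q - 1) ^ n * int_frac (of_nat (m choose i) * tree_inv i
        * tree_inv (m - i) * (\<Sum>k\<le>m - i. [:0, 1:] ^ k)))"
      by (subst aug_val_single_rec, subst sum_distrib_left, intro sum.cong refl) (rule *, simp)
    also have "\<dots> = (q - 1) ^ n * int_frac (tree_inv n)"
      unfolding Suc tree_inv.simps(2) by (simp only: of_int_poly_sum to_fract_sum sum_distrib_left)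
    finally show ?thesis .
  qed
qed

lemma aug_val_single:
  assumes "0 < a"
  shows "fact (a - 1) * aug_val [a] = (1 - q) ^ (a - 1) * int_frac (tree_inv (a - 1))"
proof -
  obtain n where a: "a = Suc n" using assms by (cases a) auto
  \<comment> \<open>The sign of the series coefficient turns (q - 1)^n into (1 - q)^n.\<close>
  have "(-1) ^ n * (fact n * fps_nth power_sum_series n) = (-1) ^ n * ((q - 1) ^ n * int_frac (tree_inv n))"
    unfolding power_sum_series_tree_inv ..
  then show ?thesis
    by (simp add: a power_sum_series_def flip: mult.assoc power_mult_distrib)
      (simp add: mult_ac flip: power_mult_distrib)
qed

end

section \<open>Integrality\<close>

text \<open>The product rule solved for \<open>a # b # \<mu>\<close> and cleared of factorials and
  powers of 1 - q; on nonempty lists of positive parts it equals (|\<mu>| - 1)! M_\<mu>. Merging two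
  parts lowers the length, so the merged terms keep a surplus factor 1 - q, which with their minus
  sign becomes q - 1.\<close>

function J_int :: "nat list \<Rightarrow> int poly" where
  "J_int [] = 0"
| "J_int [a] = tree_inv (a - 1)"
| "J_int (a # b # \<mu>) =
    of_nat ((a + sum_list (b # \<mu>) - 1) * ((a + sum_list (b # \<mu>) - 2) choose (a - 1)))
      * tree_inv (a - 1) * J_int (b # \<mu>)
    + [:-1, 1:] * (\<Sum>j<length (b # \<mu>). J_int ((b # \<mu>)[j := (b # \<mu>) ! j + a]))"
  by pat_completeness auto
termination by (relation "measure length") (auto simp del: list_update.simps)

declare J_int.simps(3) [simp del]

lemma sum_list_update_add:
  "j < length \<mu> \<Longrightarrow> sum_list (\<mu>[j := \<mu> ! j + a]) = sum_list \<mu> + (a :: nat)"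
  by (induction \<mu> arbitrary: j) (auto split: nat.split)

lemma zero_notin_list_update_add:
  "0 \<notin> set \<mu> \<Longrightarrow> (0 :: nat) < a \<Longrightarrow> 0 \<notin> set (\<mu>[j := \<mu> ! j + a])"
  using set_update_subset_insert[of \<mu> j "\<mu> ! j + a"] by auto

lemma length_le_sum_list: "0 \<notin> set \<mu> \<Longrightarrow> length \<mu> \<le> (sum_list \<mu> :: nat)"
  by (induction \<mu>) auto

text \<open>Shows that the coefficient in \<open>J_int\<close> is (a + m - 1)! / ((a - 1)! (m -
  1)!), an integer.\<close>

lemma fact_add_eq:
  assumes "0 < a" "0 < m"
  shows "fact (a + m - 1) = ((a + m - 1) * ((a + m - 2) choose (a - 1))) * fact (a - 1) * (fact (m - 1) :: nat)"
proof -
  obtain b n where ab: "a = Suc b" "m = Suc n" using assms by (metis gr0_implies_Suc)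
  have "fact b * fact n * ((b + n) choose b) = (fact (b + n) :: nat)"
    using binomial_fact_lemma[of b "b + n"] by simp
  then have "fact (Suc (b + n)) = Suc (b + n) * (fact b * fact n * ((b + n) choose b))"
    by (simp only: fact_Suc of_nat_id)
  then show ?thesis unfolding ab by (simp add: mult_ac del: fact_Suc mult_Suc mult_Suc_right)
qed

text \<open>Multiply the product rule by (|\<mu>| - 1)!. By induction the product term carries (1 -
  q)^((a-1) + (m-l)), exactly the power wanted for length l + 1, and each merged term one power
  more.\<close>

lemma aug_val_J_int:
  assumes "is_specialization \<phi>" "0 \<notin> set \<mu>" "\<mu> \<noteq> []"
  shows "fact (sum_list \<mu> - 1) * aug_val \<phi> \<mu>
    = (1 - q) ^ (sum_list \<mu> - length \<mu>) * int_frac (J_int \<mu>)"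
  using assms(2-)
proof (induction \<mu> rule: J_int.induct)
  case (2 a)
  then show ?case using aug_val_single[OF assms(1), of a] by simp
next
  case (3 a b \<mu>)
  let ?\<nu> = "b # \<mu>"
  define m where "m = sum_list ?\<nu>"
  define l where "l = length ?\<nu>"
  define c where "c = (a + m - 1) * ((a + m - 2) choose (a - 1))"
  have pos: "0 < a" "0 \<notin> set ?\<nu>" using "3.prems" by auto
  have m: "l \<le> m" "0 < m" using length_le_sum_list[OF pos(2)] pos(2)
    by (auto simp: l_def m_def)
  have IH1: "fact (m - 1) * aug_val \<phi> ?\<nu> = (1 - q) ^ (m - l) * int_frac (J_int ?\<nu>)"
    using "3.IH"(1)[OF pos(2)] by (simp add: m_def l_def)
  have IH2: "fact (a + m - 1) * aug_val \<phi> (?\<nu>[j := ?\<nu> ! j + a])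
      = (1 - q) ^ (a + m - l) * int_frac (J_int (?\<nu>[j := ?\<nu> ! j + a]))" if "j < l" for j
    using "3.IH"(2)[of j, OF _ zero_notin_list_update_add[OF pos(2,1)]] that
      sum_list_update_add[of j ?\<nu> a]
    by (simp add: m_def l_def add.commute add.left_commute del: list_update.simps)
  have "(fact (a + m - 1) :: ratfun) = of_nat c * fact (a - 1) * fact (m - 1)"
    using fact_add_eq[OF pos(1) m(2)] by (metis c_def of_nat_fact of_nat_mult)
  then have "fact (a + m - 1) * aug_val \<phi> (a # ?\<nu>) =
      of_nat c * (fact (a - 1) * aug_val \<phi> [a]) * (fact (m - 1) * aug_val \<phi> ?\<nu>)
      - (\<Sum>j<l. fact (a + m - 1) * aug_val \<phi> (?\<nu>[j := ?\<nu> ! j + a]))"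
    using aug_val_mult_single[OF assms(1) pos(2,1)]
    unfolding l_def[symmetric] by (simp add: algebra_simps sum_distrib_left)
  also have "\<dots> = of_nat c * ((1 - q) ^ (a - 1) * int_frac (tree_inv (a - 1)))
      * ((1 - q) ^ (m - l) * int_frac (J_int ?\<nu>))
      - (\<Sum>j<l. (1 - q) ^ (a + m - l) * int_frac (J_int (?\<nu>[j := ?\<nu> ! j + a])))"
    unfolding aug_val_single[OF assms(1) pos(1)] IH1 using IH2 by simp
  also have "\<dots> = (1 - q) ^ (a + m - Suc l) * (of_nat c * int_frac (tree_inv (a - 1)) * int_frac (J_int ?\<nu>)
      + (q - 1) * (\<Sum>j<l. int_frac (J_int (?\<nu>[j := ?\<nu> ! j + a]))))"
  proof -
    have 1: "(1 - q) ^ (a + m - l) = (1 - q) ^ (a + m - Suc l) * (1 - q)"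
      using pos m by (simp flip: power_Suc2 add: Suc_diff_Suc)
    have 2: "(1 - q) ^ (a - 1) * (1 - q) ^ (m - l) = (1 - q) ^ (a + m - Suc l)"
      using pos m by (simp flip: power_add)
    show ?thesis unfolding 1 2[symmetric] sum_distrib_left[symmetric] by (simp only: algebra_simps)
  qed
  also have "\<dots> = (1 - q) ^ (a + m - Suc l) * int_frac (J_int (a # ?\<nu>))"
    unfolding J_int.simps(3) c_def[symmetric] m_def[symmetric] l_def[symmetric]
    by (simp only: of_int_poly_simps of_int_poly_sum of_int_poly_of_nat to_fract_add to_fract_mult
        to_fract_sum to_fract_of_nat int_frac_X_minus_1)
  finally show ?case by (simp add: m_def l_def)
qed simp

section \<open>Degree\<close>

lemma degree_mult_leI: "degree p \<le> a \<Longrightarrow> degree p' \<le> b \<Longrightarrow> degree (p * p') \<le> a + b"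
  using degree_mult_le[of p p'] by linarith

lemma degree_of_nat_mult_leI: "degree p \<le> a \<Longrightarrow> degree (of_nat n * p) \<le> a"
  using degree_mult_le[of "of_nat n" p] by simp

lemma degree_geometric: "degree (\<Sum>k\<le>n. [:0, 1:] ^ k :: int poly) \<le> n"
  by (intro degree_sum_le) (auto simp: degree_power_eq)

lemma coeff_geometric: "coeff (\<Sum>k\<le>n. [:0, 1:] ^ k :: int poly) n = 1"
proof -
  have "[:0, 1:] ^ k = (monom 1 k :: int poly)" for k
    by (simp add: monom_altdef)
  then show ?thesis by (simp add: coeff_sum)
qed

lemma Suc_choose_two: "Suc n choose 2 = (n choose 2) + n"
  by (simp add: numeral_2_eq_2)

lemma choose_two_add: "((a + b) choose 2) = (a choose 2) + (b choose 2) + a * b"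
proof (induction a)
  case (Suc a)
  then show ?case by (simp add: Suc_choose_two)
qed simp

text \<open>With n = m + 1, summand \<open>i\<close> has degree at most C(m, 2) - i (m - i) + (m -
  i), which for i > 0 is below C(m, 2) + m = C(n, 2). Only i = 0 reaches the top, and there a monic
  polynomial is multiplied by a monic geometric sum.\<close>

lemma tree_inv_degree:
  "degree (tree_inv n) \<le> n choose 2 \<and> coeff (tree_inv n) (n choose 2) = 1"
proof (induction n rule: less_induct)
  case (less n)
  show ?case
  proof (cases n)
    case (Suc m)
    let ?g = "\<lambda>k. \<Sum>k\<le>k. [:0, 1:] ^ k :: int poly"
    let ?t = "\<lambda>i. of_nat (m choose i) * tree_inv i * tree_inv (m - i) * ?g (m - i)"
    have deg: "degree (?t i) \<le> (i choose 2) + (m - i choose 2) + (m - i)" if "i \<le> m" for i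
      using that Suc less[of i] less[of "m - i"]
      by (intro degree_mult_leI degree_of_nat_mult_leI degree_geometric) auto
    have n: "n choose 2 = (m choose 2) + m" unfolding Suc by (rule Suc_choose_two)
    have lt: "(i choose 2) + (m - i choose 2) + (m - i) < n choose 2" if "0 < i" "i \<le> m" for i
    proof -
      have "m choose 2 = (i choose 2) + (m - i choose 2) + i * (m - i)"
        using choose_two_add[of i "m - i"] that by simp
      moreover have "m - i < m" using that by simp
      ultimately show ?thesis unfolding n by simp
    qed
    have le: "(i choose 2) + (m - i choose 2) + (m - i) \<le> n choose 2" if "i \<le> m" for i
      using lt[of i] that n by (cases "i = 0") auto
    have "degree (tree_inv n) \<le> n choose 2"
      unfolding Suc tree_inv.simps(2)
      by (intro degree_sum_le) (use deg le Suc in \<open>auto intro: order.trans\<close>)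
    moreover have "coeff (tree_inv n) (n choose 2) = 1"
    proof -
      have "coeff (tree_inv n) (n choose 2) = (\<Sum>i\<le>m. coeff (?t i) (n choose 2))"
        unfolding Suc tree_inv.simps(2) coeff_sum ..
      also have "\<dots> = (\<Sum>i\<in>{0}. coeff (?t i) (n choose 2))"
      proof (intro sum.mono_neutral_right ballI)
        fix i assume "i \<in> {..m} - {0}"
        then show "coeff (?t i) (n choose 2) = 0"
          using deg[of i] lt[of i] by (intro coeff_eq_0) auto
      qed auto
      also have "\<dots> = coeff (tree_inv m * ?g m) ((m choose 2) + m)"
        using n by simp
      also have "\<dots> = 1"
      proof -
        have "degree (tree_inv m) = m choose 2"
          using less[of m] Suc by (intro antisym le_degree) auto
        moreover have "degree (?g m) = m"
          using degree_geometric[of m] coeff_geometric[of m] by (intro antisym le_degree) auto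
        ultimately show ?thesis
          using coeff_mult_degree_sum[of "tree_inv m" "?g m"] less[of m] coeff_geometric[of m] Suc
          by simp
      qed
      finally show ?thesis .
    qed
    ultimately show ?thesis by blast
  qed simp
qed

text \<open>The merged terms win: all l of them have the same size and length, hence by induction
  the same degree and leading coefficient (l - 1)!, so they add up to l! without cancellation, and q
  - 1 raises the degree by one. The product term stays below because C(a-1, 2) + C(m-1, 2) is at
  most C(a+m-1, 2).\<close>

lemma J_int_degree:
  assumes "0 \<notin> set \<mu>" "\<mu> \<noteq> []"
  shows "degree (J_int \<mu>) \<le> ((sum_list \<mu> - 1) choose 2) + length \<mu> - 1
    \<and> coeff (J_int \<mu>) (((sum_list \<mu> - 1) choose 2) + length \<mu> - 1) = fact (length \<mu> - 1)"
  using assms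
proof (induction \<mu> rule: J_int.induct)
  case (2 a)
  then show ?case using tree_inv_degree[of "a - 1"] by simp
next
  case (3 a b \<mu>)
  let ?\<nu> = "b # \<mu>"
  define m where "m = sum_list ?\<nu>"
  define l where "l = length ?\<nu>"
  define c where "c = (a + m - 1) * ((a + m - 2) choose (a - 1))"
  define N where "N = (a + m - 1) choose 2"
  define S where "S = (\<Sum>j<l. J_int (?\<nu>[j := ?\<nu> ! j + a]))"
  have pos: "0 < a" "0 \<notin> set ?\<nu>" "0 < l" using "3.prems" by (auto simp: l_def)
  have IH1: "degree (J_int ?\<nu>) \<le> ((m - 1) choose 2) + l - 1"
    using "3.IH"(1)[OF pos(2)] by (simp add: m_def l_def)
  have IH2: "degree (J_int (?\<nu>[j := ?\<nu> ! j + a])) \<le> N + l - 1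
      \<and> coeff (J_int (?\<nu>[j := ?\<nu> ! j + a])) (N + l - 1) = fact (l - 1)" if "j < l" for j
    using "3.IH"(2)[of j, OF _ zero_notin_list_update_add[OF pos(2,1)]] that
      sum_list_update_add[of j ?\<nu> a]
    by (simp add: m_def l_def N_def add.commute add.left_commute del: list_update.simps)
  have S: "degree S \<le> N + l - 1" "coeff S (N + l - 1) = fact l"
  proof -
    show "degree S \<le> N + l - 1" unfolding S_def by (intro degree_sum_le) (use IH2 in auto)
    have "coeff S (N + l - 1) = of_nat l * fact (l - 1)"
      unfolding S_def coeff_sum using IH2 by simp
    then show "coeff S (N + l - 1) = fact l" using pos(3) by (simp add: fact_reduce)
  qed
  have m: "0 < m" using pos(2) by (auto simp: m_def)
  have "((a - 1) choose 2) + ((m - 1) choose 2) \<le> N"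
  proof -
    have "a + m - 1 = Suc (a - 1 + (m - 1))" using pos(1) m by simp
    then show ?thesis
      unfolding N_def using choose_two_add[of "a - 1" "m - 1"]
      by (simp only: Suc_choose_two)
  qed
  moreover have "degree (of_nat c * tree_inv (a - 1) * J_int ?\<nu>)
      \<le> ((a - 1) choose 2) + (((m - 1) choose 2) + l - 1)"
    using tree_inv_degree[of "a - 1"]
    by (intro degree_mult_leI degree_of_nat_mult_leI IH1) blast
  ultimately have "degree (of_nat c * tree_inv (a - 1) * J_int ?\<nu>) \<le> N + l - 1"
    using pos(3) by linarith
  then have P: "degree (of_nat c * tree_inv (a - 1) * J_int ?\<nu>) < N + l"
    using pos(3) by simp
  have J: "J_int (a # ?\<nu>) = of_nat c * tree_inv (a - 1) * J_int ?\<nu> + [:-1, 1:] * S"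
    unfolding J_int.simps(3) c_def[symmetric] m_def[symmetric] l_def[symmetric] S_def[symmetric] ..
  have "degree ([:-1, 1:] * S) \<le> N + l"
    using degree_mult_leI[of "[:-1, 1:]" 1 S, OF _ S(1)] pos(3) by simp
  then have "degree (J_int (a # ?\<nu>)) \<le> N + l"
    unfolding J using P by (intro degree_add_le) auto
  moreover have "coeff ([:-1, 1:] * S) (N + l) = fact l"
  proof -
    obtain k where k: "N + l = Suc k" using pos(3) by (metis add_gr_0 gr0_implies_Suc)
    have "coeff S (Suc k) = 0" using S(1) k by (intro coeff_eq_0) auto
    then show ?thesis using S(2) k by simp
  qed
  then have "coeff (J_int (a # ?\<nu>)) (N + l) = fact l"
    unfolding J using coeff_eq_0[OF P] by simp
  moreover have "sum_list (a # ?\<nu>) - 1 = a + m - 1" "length (a # ?\<nu>) - 1 = l"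
    by (simp_all add: m_def l_def)
  moreover have "N + length (a # ?\<nu>) - 1 = N + l"
    by (simp add: l_def)
  ultimately show ?case by (simp only: N_def)
qed simp

section \<open>Order\<close>

text \<open>Stands in for 2 n(\<mu>) + |\<mu>| but is defined on unordered exponents, so monomials
  can be compared without sorting.\<close>

definition min_sum :: "nat multiset \<Rightarrow> nat" where
  "min_sum E = (\<Sum>x\<in>#E. \<Sum>y\<in>#E. min x y)"

lemma min_sum_empty [simp]: "min_sum {#} = 0"
  by (simp add: min_sum_def)

lemma min_sum_add_mset: "min_sum (add_mset a E) = a + 2 * (\<Sum>y\<in>#E. min a y) + min_sum E"
proof -
  have "(\<Sum>x\<in>#E. min x a) = (\<Sum>x\<in>#E. min a x)" by (simp add: min.commute)
  then show ?thesis by (simp add: min_sum_def sum_mset.distrib)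
qed

text \<open>A head \<open>a\<close> that dominates the list has min a y = y, so it adds a + 2
  |\<mu>| on the left; on the right n grows by |\<mu>| since every other part moves one
  place.\<close>

lemma min_sum_mset_partition:
  "sorted_wrt (\<ge>) \<mu> \<Longrightarrow> min_sum (mset \<mu>) = 2 * part_n \<mu> + sum_list \<mu>"
proof (induction \<mu>)
  case (Cons a \<mu>)
  have "part_n (a # \<mu>) = (\<Sum>i<length \<mu>. Suc i * \<mu> ! i)"
    unfolding part_n_def by (simp only: list.size(4) add_Suc_right add_0_right sum.lessThan_Suc_shift) simp
  also have "\<dots> = part_n \<mu> + sum_list \<mu>"
    by (simp add: part_n_def sum.distrib sum_list_sum_nth atLeast0LessThan)
  finally have "part_n (a # \<mu>) = part_n \<mu> + sum_list \<mu>" .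
  moreover have "(\<Sum>y\<in>#mset \<mu>. min a y) = (\<Sum>y\<in>#mset \<mu>. y)"
    using Cons.prems by (intro arg_cong[of _ _ sum_mset] image_mset_cong) auto
  ultimately show ?case
    using Cons by (simp add: min_sum_add_mset sum_mset_sum_list)
qed (simp add: part_n_def)

text \<open>Bounds n within a fixed size, so that induction towards larger n terminates.\<close>

lemma min_sum_le: "min_sum E \<le> (\<Sum>\<^sub># E)\<^sup>2"
proof (induction E)
  case (add a E)
  have min: "min a y \<le> a * y" for y :: nat by (cases "a = 0"; cases "y = 0") (auto simp: min_def)
  have "(\<Sum>y\<in>#E. min a y) \<le> (\<Sum>y\<in>#E. a * y)" by (intro sum_mset_mono min)
  then have "(\<Sum>y\<in>#E. min a y) \<le> a * \<Sum>\<^sub># E" by (simp add: sum_mset_distrib_left[of a "\<lambda>x. x" E, simplified])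
  moreover have "a \<le> a\<^sup>2" by (simp add: power2_eq_square)
  ultimately show ?case
    using add by (simp add: min_sum_add_mset power2_sum)
qed simp

text \<open>A new first column raises each of the (size E)^2 minima by one; entries 0 count as
  rows.\<close>

lemma min_sum_image_Suc: "min_sum (image_mset Suc E) = (size E)\<^sup>2 + min_sum E"
proof (induction E)
  case (add a E)
  have "(\<Sum>y\<in>#E. min (Suc a) (Suc y)) = size E + (\<Sum>y\<in>#E. min a y)"
    by (induction E) auto
  with add show ?case
    by (simp add: min_sum_add_mset multiset.map_comp comp_def power2_eq_square)
qed simp

lemma min_sum_add_zeros: "min_sum (E + replicate_mset n 0) = min_sum E"
  by (induction n) (auto simp: min_sum_add_mset)

lemma min_sum_exponents:
  assumes "finite A" "Poly_Mapping.keys a \<subseteq> A"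
  shows "min_sum (exponents a)
    = (\<Sum>i\<in>A. \<Sum>j\<in>A. min (Poly_Mapping.lookup a i) (Poly_Mapping.lookup a j))"
proof -
  have "min_sum (exponents a) = (\<Sum>i\<in>Poly_Mapping.keys a. \<Sum>j\<in>Poly_Mapping.keys a.
      min (Poly_Mapping.lookup a i) (Poly_Mapping.lookup a j))"
    by (simp add: min_sum_def exponents_def sum_unfold_sum_mset multiset.map_comp comp_def)
  also have "\<dots> = (\<Sum>i\<in>A. \<Sum>j\<in>Poly_Mapping.keys a.
      min (Poly_Mapping.lookup a i) (Poly_Mapping.lookup a j))"
    using assms by (intro sum.mono_neutral_left) (auto simp: in_keys_iff)
  also have "\<dots> = (\<Sum>i\<in>A. \<Sum>j\<in>A. min (Poly_Mapping.lookup a i) (Poly_Mapping.lookup a j))"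
    using assms by (intro sum.cong sum.mono_neutral_left) (auto simp: in_keys_iff)
  finally show ?thesis .
qed

text \<open>The minimum is superadditive for each pair of variables. The cardinalities give a
  variable \<open>i\<close> of \<open>b\<close> only, besides a variable \<open>j\<close> of
  \<open>c\<close> only; at the pair \<open>(i, j)\<close> both minima on the left are 0 and the one
  on the right is positive.\<close>

lemma min_sum_strictly_superadditive:
  assumes b: "\<And>i. Poly_Mapping.lookup b i \<le> 1"
    and card: "card (Poly_Mapping.keys c) \<le> card (Poly_Mapping.keys b)"
    and not_sub: "\<not> Poly_Mapping.keys c \<subseteq> Poly_Mapping.keys b"
  shows "min_sum (exponents b) + min_sum (exponents c) < min_sum (exponents (b + c))"
proof -
  let ?A = "Poly_Mapping.keys b \<union> Poly_Mapping.keys c"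
  obtain j where j: "j \<in> Poly_Mapping.keys c" "j \<notin> Poly_Mapping.keys b" using not_sub by auto
  have "\<not> Poly_Mapping.keys b \<subseteq> Poly_Mapping.keys c"
    using card j by (metis card_subset_eq finite_keys card_mono le_antisym)
  then obtain i where i: "i \<in> Poly_Mapping.keys b" "i \<notin> Poly_Mapping.keys c" by auto
  let ?m = "\<lambda>a i j. min (Poly_Mapping.lookup a i) (Poly_Mapping.lookup a j)"
  have le: "?m b x y + ?m c x y \<le> ?m (b + c) x y" for x y by (simp add: lookup_add min_def)
  have lt: "?m b i j + ?m c i j < ?m (b + c) i j"
    using i j by (auto simp: lookup_add in_keys_iff)
  have "(\<Sum>x\<in>?A. \<Sum>y\<in>?A. ?m b x y + ?m c x y) < (\<Sum>x\<in>?A. \<Sum>y\<in>?A. ?m (b + c) x y)"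
  proof (rule sum_strict_mono_ex1)
    show "\<forall>x\<in>?A. (\<Sum>y\<in>?A. ?m b x y + ?m c x y) \<le> (\<Sum>y\<in>?A. ?m (b + c) x y)"
      by (intro ballI sum_mono le)
    have "(\<Sum>y\<in>?A. ?m b i y + ?m c i y) < (\<Sum>y\<in>?A. ?m (b + c) i y)"
      by (rule sum_strict_mono_ex1) (use le lt j in auto)
    then show "\<exists>x\<in>?A. (\<Sum>y\<in>?A. ?m b x y + ?m c x y) < (\<Sum>y\<in>?A. ?m (b + c) x y)"
      using i by blast
  qed simp
  then show ?thesis
    using Poly_Mapping.keys_add[of b c] by (simp add: min_sum_exponents[of ?A] sum.distrib)
qed

section \<open>Multiplication by e_l and the first column\<close>

definition remove_column :: "nat list \<Rightarrow> nat list" where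
  "remove_column \<mu> = filter (\<lambda>x. x \<noteq> 0) (map (\<lambda>x. x - 1) \<mu>)"

lemma multiset_conv_nonzero:
  "M = filter_mset (\<lambda>x. x \<noteq> 0) M + replicate_mset (size M - size (filter_mset (\<lambda>x. x \<noteq> 0) M)) 0"
proof -
  have "filter_mset (\<lambda>x. \<not> x \<noteq> 0) M = replicate_mset (count M 0) 0"
    using filter_eq_replicate_mset[of 0 M] by (simp add: eq_commute[of 0])
  then have *: "M = filter_mset (\<lambda>x. x \<noteq> 0) M + replicate_mset (count M 0) 0"
    using multiset_partition[of M "\<lambda>x. x \<noteq> 0"] by simp
  have "size M = size (filter_mset (\<lambda>x. x \<noteq> 0) M) + count M 0"
    using arg_cong[OF *, of size] by simp
  then have "size M - size (filter_mset (\<lambda>x. x \<noteq> 0) M) = count M 0" by simp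
  with * show ?thesis by simp
qed

text \<open>Parts equal to 1 disappear with the column; they are put back as zeros before every
  entry is raised by one.\<close>

lemma mset_conv_remove_column:
  assumes "0 \<notin> set \<mu>"
  shows "mset \<mu> = image_mset Suc (mset (remove_column \<mu>)
    + replicate_mset (length \<mu> - length (remove_column \<mu>)) 0)"
proof -
  let ?M = "mset (map (\<lambda>x. x - 1) \<mu>)"
  have f: "filter_mset (\<lambda>x. x \<noteq> 0) ?M = mset (remove_column \<mu>)"
    unfolding remove_column_def by simp
  have "?M = mset (remove_column \<mu>) + replicate_mset (length \<mu> - length (remove_column \<mu>)) 0"
    using multiset_conv_nonzero[of ?M] unfolding f by simp
  then have "image_mset Suc ?M = image_mset Suc (mset (remove_column \<mu>)
      + replicate_mset (length \<mu> - length (remove_column \<mu>)) 0)"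
    by (rule arg_cong)
  moreover have "mset \<mu> = image_mset Suc ?M"
  proof -
    have "map (\<lambda>x. Suc (x - 1)) \<mu> = \<mu>" using assms by (induction \<mu>) auto
    then show ?thesis by (metis (no_types, lifting) mset_map map_map comp_apply map_eq_conv)
  qed
  ultimately show ?thesis by (rule trans[rotated])
qed

lemma length_remove_column: "length (remove_column \<mu>) \<le> length \<mu>"
  unfolding remove_column_def by (metis length_filter_le length_map)

lemma sum_list_remove_column:
  "0 \<notin> set \<mu> \<Longrightarrow> sum_list \<mu> = length \<mu> + sum_list (remove_column \<mu>)"
  by (induction \<mu>) (auto simp: remove_column_def)

lemma min_sum_remove_column:
  assumes "0 \<notin> set \<mu>"
  shows "min_sum (mset \<mu>) = (length \<mu>)\<^sup>2 + min_sum (mset (remove_column \<mu>))"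
  by (subst mset_conv_remove_column[OF assms])
    (simp add: min_sum_image_Suc min_sum_add_zeros length_remove_column del: image_mset_union)

lemma is_partition_remove_column: "is_partition \<mu> \<Longrightarrow> is_partition (remove_column \<mu>)"
  unfolding is_partition_def remove_column_def
  by (auto intro!: sorted_wrt_filter simp: sorted_wrt_map elim!: sorted_wrt_mono_rel[rotated])

lemma image_lookup_conv_exponents:
  assumes "finite A" "Poly_Mapping.keys c \<subseteq> A"
  shows "image_mset (Poly_Mapping.lookup c) (mset_set A)
    = exponents c + replicate_mset (card A - card (Poly_Mapping.keys c)) 0"
proof -
  have "mset_set A = mset_set (Poly_Mapping.keys c) + mset_set (A - Poly_Mapping.keys c)"
    using assms by (metis Diff_disjoint Diff_partition finite_Diff finite_keys mset_set_Union)
  moreover have "image_mset (Poly_Mapping.lookup c) (mset_set (A - Poly_Mapping.keys c))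
      = image_mset (\<lambda>_. 0) (mset_set (A - Poly_Mapping.keys c))"
    using assms by (intro image_mset_cong) (auto simp: in_keys_iff)
  ultimately show ?thesis
    using assms by (simp add: exponents_def image_mset_const_eq card_Diff_subset)
qed

lemma size_exponents: "size (exponents a) = card (Poly_Mapping.keys a)"
  by (simp add: exponents_def)

lemma zero_notin_exponents: "0 \<notin># exponents a"
  by (auto simp: exponents_def in_keys_iff)

text \<open>The case excluded from \<open>min_sum_strictly_superadditive\<close>: if the support of
  \<open>c\<close> lies in that of \<open>b\<close>, the product adds exactly one column.\<close>

lemma exponents_add_column:
  assumes \<mu>: "0 \<notin> set \<mu>"
    and b: "\<And>i. Poly_Mapping.lookup b i \<le> 1" "card (Poly_Mapping.keys b) = length \<mu>"
    and c: "exponents c = mset (remove_column \<mu>)" "Poly_Mapping.keys c \<subseteq> Poly_Mapping.keys b"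
  shows "exponents (b + c) = mset \<mu>"
proof -
  let ?A = "Poly_Mapping.keys b"
  have lookup_b: "Poly_Mapping.lookup b i = 1" if "i \<in> ?A" for i
    using that b(1)[of i] by (auto simp: in_keys_iff)
  have keys: "Poly_Mapping.keys (b + c) = ?A"
    using c(2) unfolding subset_iff set_eq_iff in_keys_iff lookup_add by auto
  have "card (Poly_Mapping.keys c) = length (remove_column \<mu>)"
    using arg_cong[OF c(1), of size] by (simp add: size_exponents)
  have "exponents (b + c) = image_mset (\<lambda>i. Suc (Poly_Mapping.lookup c i)) (mset_set ?A)"
    unfolding exponents_def keys by (intro image_mset_cong) (auto simp: lookup_add lookup_b)
  also have "\<dots> = image_mset Suc (image_mset (Poly_Mapping.lookup c) (mset_set ?A))"
    by (simp add: multiset.map_comp comp_def)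
  also have "\<dots> = mset \<mu>"
    unfolding image_lookup_conv_exponents[OF finite_keys c(2)] c(1) b(2)
      \<open>card (Poly_Mapping.keys c) = length (remove_column \<mu>)\<close>
    by (rule mset_conv_remove_column[OF \<mu>, symmetric])
  finally show ?thesis .
qed

text \<open>A squarefree divisor of \<open>a\<close> with l variables must use the whole support of
  \<open>a\<close>, which has l elements. So there is just one splitting: \<open>b\<close> is the
  indicator of the support, and \<open>c\<close> has all positive exponents lowered by one.\<close>

lemma coeff_elem_sym_mult_remove_column:
  assumes \<mu>: "0 \<notin> set \<mu>" and a: "exponents a = mset \<mu>"
  shows "sf_coeff (elem_sym (length \<mu>) * mono_sym (remove_column \<mu>) :: 'a :: comm_ring_1 symfun) a = 1"
proof -
  define b c where "b = Poly_Mapping.map (\<lambda>_. 1 :: nat) a" and "c = Poly_Mapping.map (\<lambda>x. x - 1) a"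
  have lookup_b: "Poly_Mapping.lookup b i = (if i \<in> Poly_Mapping.keys a then 1 else 0)" for i
    by (simp add: b_def map.rep_eq in_keys_iff when_def)
  have lookup_c: "Poly_Mapping.lookup c i = Poly_Mapping.lookup a i - 1" for i
    by (simp add: c_def map.rep_eq when_def)
  have card_a: "card (Poly_Mapping.keys a) = length \<mu>"
    using arg_cong[OF a, of size] by (simp add: size_exponents)
  have keys_b: "Poly_Mapping.keys b = Poly_Mapping.keys a"
    using lookup_b by (auto simp: in_keys_iff split: if_splits)
  have bc: "b + c = a"
    by (rule poly_mapping_eqI) (auto simp: lookup_add lookup_b lookup_c in_keys_iff)
  have exp_c: "exponents c = mset (remove_column \<mu>)"
  proof -
    have sub: "Poly_Mapping.keys c \<subseteq> Poly_Mapping.keys a"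
      by (auto simp: in_keys_iff lookup_c)
    have "mset (map (\<lambda>x. x - 1) \<mu>) = image_mset (Poly_Mapping.lookup c) (mset_set (Poly_Mapping.keys a))"
      unfolding mset_map a[symmetric] exponents_def by (auto simp: multiset.map_comp lookup_c intro!: image_mset_cong)
    also have "\<dots> = exponents c + replicate_mset (card (Poly_Mapping.keys a) - card (Poly_Mapping.keys c)) 0"
      using sub by (rule image_lookup_conv_exponents[OF finite_keys])
    finally have "mset (remove_column \<mu>) = filter_mset (\<lambda>x. x \<noteq> 0) \<dots>"
      unfolding remove_column_def mset_filter by simp
    also have "\<dots> = exponents c"
      by (rule multiset_eqI) (use zero_notin_exponents[of c] in \<open>auto simp: not_in_iff\<close>)
    finally show ?thesis ..
  qed
  have unique: "x = b \<and> y = c" if "x + y = a" "card (Poly_Mapping.keys x) = length \<mu>"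
    "\<forall>i. Poly_Mapping.lookup x i \<le> 1" for x y
  proof -
    have "Poly_Mapping.keys x \<subseteq> Poly_Mapping.keys a"
      using that(1) by (auto simp: in_keys_iff lookup_add)
    then have "Poly_Mapping.keys x = Poly_Mapping.keys a"
      using that(2) card_a by (intro card_subset_eq) auto
    then have keys_x: "Poly_Mapping.lookup x i \<noteq> 0 \<longleftrightarrow> i \<in> Poly_Mapping.keys a" for i
      by (metis in_keys_iff)
    have "Poly_Mapping.lookup x i = Poly_Mapping.lookup b i" for i
      using that(3)[rule_format, of i] keys_x[of i] unfolding lookup_b
      by (cases "i \<in> Poly_Mapping.keys a") auto
    then have "x = b" by (rule poly_mapping_eqI)
    then show ?thesis using that(1) bc by auto
  qed
  have "sf_coeff (elem_sym (length \<mu>) * mono_sym (remove_column \<mu>) :: 'a symfun) a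
      = (\<Sum>(x, y)\<in>splits a. sf_coeff (elem_sym (length \<mu>)) x * sf_coeff (mono_sym (remove_column \<mu>)) y)"
    by (simp add: times_symfun.rep_eq)
  also have "\<dots> = (\<Sum>(x, y)\<in>{(b, c)}. sf_coeff (elem_sym (length \<mu>)) x * sf_coeff (mono_sym (remove_column \<mu>)) y)"
  proof (rule sum.mono_neutral_right[OF finite_splits])
    show "{(b, c)} \<subseteq> splits a" using bc by (simp add: splits_def)
    show "\<forall>p\<in>splits a - {(b, c)}. (case p of (x, y) \<Rightarrow>
        sf_coeff (elem_sym (length \<mu>)) x * sf_coeff (mono_sym (remove_column \<mu>)) y) = (0 :: 'a)"
    proof
      fix p assume p: "p \<in> splits a - {(b, c)}"
      obtain x y where xy: "p = (x, y)" by (cases p)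
      with p have "x + y = a" "\<not> (x = b \<and> y = c)" by (simp_all add: splits_def)
      then have "\<not> (card (Poly_Mapping.keys x) = length \<mu> \<and> (\<forall>i. Poly_Mapping.lookup x i \<le> 1))"
        using unique by blast
      then have "sf_coeff (elem_sym (length \<mu>) :: 'a symfun) x = 0"
        by (simp only: elem_sym.rep_eq if_False)
      then show "(case p of (x, y) \<Rightarrow>
        sf_coeff (elem_sym (length \<mu>)) x * sf_coeff (mono_sym (remove_column \<mu>)) y) = (0 :: 'a)"
        by (simp add: xy)
    qed
  qed
  also have "\<dots> = 1"
    by (simp add: elem_sym.rep_eq mono_sym.rep_eq exp_c keys_b card_a lookup_b)
  finally show ?thesis .
qed

text \<open>
  The coefficientwise form of \<open>e\<^sub>l m\<^sub>\<nu> = m\<^sub>\<mu> + (terms of larger n)\<close>, where \<open>\<nu>\<close> is \<open>\<mu>\<close> without its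
  first column, of length \<open>l\<close>.
\<close>

lemma elem_sym_mult_remove_column:
  fixes \<mu> :: "nat list"
  defines "f \<equiv> elem_sym (length \<mu>) * mono_sym (remove_column \<mu>) - mono_sym \<mu> :: 'a :: comm_ring_1 symfun"
  assumes \<mu>: "0 \<notin> set \<mu>"
  shows "sf_coeff f a \<in> \<int>"
    and "sf_coeff f a \<noteq> 0 \<Longrightarrow>
      min_sum (mset \<mu>) < min_sum (exponents a) \<and> \<Sum>\<^sub># (exponents a) = sum_list \<mu>"
proof -
  let ?g = "elem_sym (length \<mu>) :: 'a symfun" and ?h = "mono_sym (remove_column \<mu>) :: 'a symfun"
  have f: "sf_coeff f a = (\<Sum>(x, y)\<in>splits a. sf_coeff ?g x * sf_coeff ?h y) - sf_coeff (mono_sym \<mu>) a"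
    by (simp add: f_def minus_symfun.rep_eq times_symfun.rep_eq)
  show "sf_coeff f a \<in> \<int>"
    unfolding f by (intro Ints_diff Ints_sum) (auto simp: elem_sym.rep_eq mono_sym.rep_eq)
  assume nz: "sf_coeff f a \<noteq> 0"
  \<comment> \<open>On monomials of type \<mu> both coefficients are 1 and cancel.\<close>
  have ne: "exponents a \<noteq> mset \<mu>"
  proof
    assume "exponents a = mset \<mu>"
    then show False
      using nz coeff_elem_sym_mult_remove_column[OF \<mu>, of a, where 'a = 'a]
      by (simp add: f_def minus_symfun.rep_eq mono_sym.rep_eq)
  qed
  then have "(\<Sum>(x, y)\<in>splits a. sf_coeff ?g x * sf_coeff ?h y) \<noteq> 0"
    using nz by (simp add: f mono_sym.rep_eq)
  then obtain p where "p \<in> splits a" "(case p of (x, y) \<Rightarrow> sf_coeff ?g x * sf_coeff ?h y) \<noteq> 0"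
    by (rule sum.not_neutral_contains_not_neutral)
  then obtain b c where bc: "b + c = a" "card (Poly_Mapping.keys b) = length \<mu>"
    "\<And>i. Poly_Mapping.lookup b i \<le> 1" "exponents c = mset (remove_column \<mu>)"
    by (auto simp: splits_def elem_sym.rep_eq mono_sym.rep_eq split: if_splits)
  have b: "exponents b = mset (replicate (length \<mu>) 1)"
    using bc by (subst exponents_eq_ones_iff) auto
  have min_b: "min_sum (exponents b) = (length \<mu>)\<^sup>2"
    using min_sum_image_Suc[of "replicate_mset (length \<mu>) 0"]
      min_sum_add_zeros[of "{#}" "length \<mu>"] by (simp add: b)
  have "card (Poly_Mapping.keys c) = length (remove_column \<mu>)"
    using arg_cong[OF bc(4), of size] by (simp add: size_exponents)
  then have "card (Poly_Mapping.keys c) \<le> card (Poly_Mapping.keys b)"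
    using length_remove_column[of \<mu>] bc(2) by simp
  \<comment> \<open>A contained support would lead back to type \<mu>, which \<open>ne\<close> rules
    out.\<close>
  moreover have "\<not> Poly_Mapping.keys c \<subseteq> Poly_Mapping.keys b"
    using exponents_add_column[OF \<mu> bc(3,2,4)] bc(1) ne by auto
  ultimately have "min_sum (exponents b) + min_sum (exponents c) < min_sum (exponents a)"
    using min_sum_strictly_superadditive[OF bc(3)] bc(1) by blast
  then have "min_sum (mset \<mu>) < min_sum (exponents a)"
    unfolding min_b bc(4) min_sum_remove_column[OF \<mu>] .
  moreover have "\<Sum>\<^sub># (exponents a) = sum_list \<mu>"
    using mdeg_add[of b c] sum_list_remove_column[OF \<mu>]
    by (simp add: bc mdeg_conv_exponents b sum_mset_sum_list sum_list_replicate)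
  ultimately show "min_sum (mset \<mu>) < min_sum (exponents a) \<and> \<Sum>\<^sub># (exponents a) = sum_list \<mu>" ..
qed

section \<open>Expansion into monomial symmetric functions\<close>

text \<open>Equal exponents mean equally large supports, so over the union of the supports both are
  padded by the same number of zeros; a permutation of that union carries one monomial to the
  other.\<close>

lemma sf_coeff_exponents_cong:
  assumes "exponents a = exponents b"
  shows "sf_coeff f a = sf_coeff f b"
proof -
  let ?A = "Poly_Mapping.keys a \<union> Poly_Mapping.keys b"
  have "card (Poly_Mapping.keys a) = card (Poly_Mapping.keys b)"
    using arg_cong[OF assms, of size] by (simp add: size_exponents)
  then have "image_mset (Poly_Mapping.lookup a) (mset_set ?A) = image_mset (Poly_Mapping.lookup b) (mset_set ?A)"
    using assms by (simp add: image_lookup_conv_exponents)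
  then obtain p where p: "p permutes ?A" "\<forall>x\<in>?A. Poly_Mapping.lookup a x = Poly_Mapping.lookup b (p x)"
    by (rule image_mset_eq_implies_permutes[rotated]) auto
  have bij: "bij p" using p(1) by (rule permutes_bij)
  have "Poly_Mapping.lookup a x = Poly_Mapping.lookup b (p x)" for x
  proof (cases "x \<in> ?A")
    case True
    then show ?thesis using p(2) by blast
  next
    case False
    then show ?thesis using permutes_not_in[OF p(1) False] by (simp add: in_keys_iff)
  qed
  then have "a = Poly_Mapping.map_key p b"
    by (intro poly_mapping_eqI) (simp add: map_key.rep_eq bij_is_inj[OF bij])
  then show ?thesis using sf_coeff[of f] bij by auto
qed

definition part_of :: "monom_exp \<Rightarrow> nat list" where
  "part_of a = rev (sorted_list_of_multiset (exponents a))"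

lemma mset_part_of [simp]: "mset (part_of a) = exponents a"
  by (simp add: part_of_def)

lemma is_partition_part_of: "is_partition (part_of a)"
proof -
  have "set (part_of a) = set_mset (exponents a)"
    by (metis mset_part_of set_mset_mset)
  then show ?thesis
    using zero_notin_exponents[of a] by (auto simp: is_partition_def part_of_def sorted_wrt_rev intro: gr0I)
qed

lemma finite_exponents_support: "finite (exponents ` {a. sf_coeff f a \<noteq> 0})"
proof -
  obtain d where d: "\<And>a. sf_coeff f a \<noteq> 0 \<Longrightarrow> mdeg a \<le> d" using sf_coeff[of f] by auto
  have "exponents ` {a. sf_coeff f a \<noteq> 0} \<subseteq> mset ` {xs. set xs \<subseteq> {..d} \<and> length xs \<le> d}"
  proof (intro image_subsetI)
    fix a assume "a \<in> {a. sf_coeff f a \<noteq> 0}"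
    then have "sum_list (part_of a) \<le> d"
      using d[of a] by (simp add: mdeg_conv_exponents flip: sum_mset_sum_list)
    moreover have "0 \<notin> set (part_of a)" using is_partition_part_of[of a] by (auto simp: is_partition_def)
    ultimately have "part_of a \<in> {xs. set xs \<subseteq> {..d} \<and> length xs \<le> d}"
      using length_le_sum_list[of "part_of a"] member_le_sum_list[of _ "part_of a"]
      by (auto intro: order.trans)
    then show "exponents a \<in> mset ` {xs. set xs \<subseteq> {..d} \<and> length xs \<le> d}"
      by (metis imageI mset_part_of)
  qed
  then show ?thesis by (rule finite_subset) (simp add: finite_lists_length_le)
qed

text \<open>\<open>B\<close> holds one monomial for each exponent multiset that occurs.\<close>

lemma symfun_expand:
  "\<exists>B. finite B \<and> (\<forall>a\<in>B. sf_coeff f a \<noteq> 0) \<and> f = (\<Sum>a\<in>B. sf_scale (sf_coeff f a) (mono_sym (part_of a)))"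
proof -
  obtain B where B: "B \<subseteq> {a. sf_coeff f a \<noteq> 0}" "finite B"
    "exponents ` {a. sf_coeff f a \<noteq> 0} = exponents ` B" "inj_on exponents B"
    using finite_exponents_support[of f] subset_image_inj[of "exponents ` {a. sf_coeff f a \<noteq> 0}" exponents "{a. sf_coeff f a \<noteq> 0}"]
    by (metis finite_image_iff order.refl)
  have "f = (\<Sum>a\<in>B. sf_scale (sf_coeff f a) (mono_sym (part_of a)))"
  proof (rule sf_eqI)
    fix c
    have "sf_coeff (\<Sum>a\<in>B. sf_scale (sf_coeff f a) (mono_sym (part_of a))) c
        = (\<Sum>a\<in>B. if exponents c = exponents a then sf_coeff f a else 0)"
      by (auto simp: sf_coeff_sum sf_scale.rep_eq mono_sym.rep_eq intro!: sum.cong)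
    also have "\<dots> = sf_coeff f c"
    proof (cases "sf_coeff f c = 0")
      case True
      then have "(if exponents c = exponents a then sf_coeff f a else 0) = 0" for a
        using sf_coeff_exponents_cong[of c a f] by auto
      then show ?thesis using True by (simp only: sum.neutral_const)
    next
      case False
      then have "exponents c \<in> exponents ` B" using B(3) by auto
      then obtain b where b: "b \<in> B" "exponents c = exponents b" by auto
      have "(\<Sum>a\<in>B. if exponents c = exponents a then sf_coeff f a else 0)
          = (\<Sum>a\<in>B. if a = b then sf_coeff f b else 0)"
        using B(4) b by (intro sum.cong) (auto simp: inj_on_def)
      also have "\<dots> = sf_coeff f c" using b B(2) sf_coeff_exponents_cong[OF b(2), of f] by simp
      finally show ?thesis .
    qed
    finally show "sf_coeff f c = sf_coeff (\<Sum>a\<in>B. sf_scale (sf_coeff f a) (mono_sym (part_of a))) c" ..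
  qed
  then show ?thesis using B by blast
qed

section \<open>The lowest power of q\<close>

lemma choose_two_eq: "2 * (l choose 2) + l = l\<^sup>2"
  by (induction l) (auto simp: Suc_choose_two power2_eq_square binomial_eq_0)

text \<open>Apply \<phi> to e_l m_\<nu> = m_\<mu> + (terms of larger n). The left side has lowest
  power C(l, 2) + n(\<nu>) = n(\<mu>), and by induction every correction is divisible by
  q^(n(\<mu>)+1).\<close>

lemma specialization_order:
  assumes spec: "is_specialization \<phi>" and "is_partition \<mu>"
  shows "\<exists>r. \<phi> (mono_sym \<mu>) = q ^ part_n \<mu> * to_fract r \<and> coeff r 0 \<noteq> 0"
  using assms(2)
\<comment> \<open>\<nu> has smaller size than \<mu>; the corrections have the same size and larger
  n.\<close>
proof (induction \<mu> rule: wf_induct_rule[OF wf_measures,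
    of "[sum_list, \<lambda>\<mu>. (sum_list \<mu>)\<^sup>2 - part_n \<mu>]"])
  case (1 \<mu>)
  show ?case
  proof (cases "\<mu> = []")
    case True
    then have "\<phi> (mono_sym \<mu>) = 1"
      using \<phi>_elem_sym[OF spec, of 0] by (simp add: elem_sym_conv_mono_sym numeral_2_eq_2)
    then show ?thesis using True by (intro exI[of _ 1]) (simp add: part_n_def)
  next
    case False
    define l \<nu> where "l = length \<mu>" and "\<nu> = remove_column \<mu>"
    define n where "n = part_n \<mu>"
    define f :: "ratfun symfun" where "f = elem_sym l * mono_sym \<nu> - mono_sym \<mu>"
    have \<mu>: "0 \<notin> set \<mu>" using "1.prems" by (auto simp: is_partition_def)
    have part: "min_sum (mset \<mu>) = 2 * part_n \<mu> + sum_list \<mu>" if "is_partition \<mu>" for \<mu>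
      using that by (intro min_sum_mset_partition) (simp add: is_partition_def)
    have \<nu>: "is_partition \<nu>" using "1.prems" unfolding \<nu>_def by (rule is_partition_remove_column)
    have sum: "sum_list \<mu> = l + sum_list \<nu>"
      using sum_list_remove_column[OF \<mu>] by (simp add: l_def \<nu>_def)
    \<comment> \<open>Twice n plus the size is \<open>min_sum\<close>, for \<mu> and for \<nu>; the
      difference C(l, 2) matches the power of q in the image of e_l.\<close>
    have n: "n = (l choose 2) + part_n \<nu>"
      using min_sum_remove_column[OF \<mu>] part[OF "1.prems"] part[OF \<nu>] sum choose_two_eq[of l]
      by (simp add: n_def l_def \<nu>_def)
    have "0 < l" using False by (simp add: l_def)
    then obtain r where r: "\<phi> (mono_sym \<nu>) = q ^ part_n \<nu> * to_fract r" "coeff r 0 \<noteq> 0"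
      using "1.IH"[OF _ \<nu>] sum by auto
    have "\<exists>s. \<phi> (sf_scale (sf_coeff f a) (mono_sym (part_of a))) = q ^ Suc n * to_fract s"
      if "sf_coeff f a \<noteq> 0" for a
    proof -
      note f = elem_sym_mult_remove_column[OF \<mu>, where 'a = ratfun, folded l_def \<nu>_def, folded f_def]
      \<comment> \<open>Integer coefficients keep the corrections polynomial in q.\<close>
      obtain k where k: "sf_coeff f a = of_int k" using f(1)[of a] by (auto elim: Ints_cases)
      have a: "sum_list (part_of a) = sum_list \<mu>"
        using f(2)[OF that] by (simp flip: sum_mset_sum_list)
      have lt: "n < part_n (part_of a)"
        using f(2)[OF that] part[OF "1.prems"] part[OF is_partition_part_of, of a] a by (simp add: n_def)
      \<comment> \<open>Without this bound the truncated subtraction in the measure need not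
        decrease.\<close>
      have "part_n (part_of a) \<le> (sum_list \<mu>)\<^sup>2"
        using min_sum_le[of "mset (part_of a)"] part[OF is_partition_part_of, of a]
        unfolding sum_mset_sum_list a by simp
      then have "(part_of a, \<mu>) \<in> measures [sum_list, \<lambda>\<mu>. (sum_list \<mu>)\<^sup>2 - part_n \<mu>]"
        using a lt by (auto simp: n_def)
      then obtain s where s: "\<phi> (mono_sym (part_of a)) = q ^ part_n (part_of a) * to_fract s"
        using "1.IH"[OF _ is_partition_part_of] by blast
      have "q ^ part_n (part_of a) = q ^ Suc n * q ^ (part_n (part_of a) - Suc n)"
        using lt by (simp flip: power_add power_Suc)
      moreover have "(of_int k :: ratfun) = to_fract (of_int k)"
        by (cases k) (auto simp: simp flip: of_nat_Suc)
      ultimately have "\<phi> (sf_scale (sf_coeff f a) (mono_sym (part_of a)))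
          = q ^ Suc n * to_fract (of_int k * [:0, 1:] ^ (part_n (part_of a) - Suc n) * s)"
        unfolding \<phi>_scale[OF spec] s k by (simp add: q_def)
      then show ?thesis ..
    qed
    then obtain S where S: "\<And>a. sf_coeff f a \<noteq> 0 \<Longrightarrow>
        \<phi> (sf_scale (sf_coeff f a) (mono_sym (part_of a))) = q ^ Suc n * to_fract (S a)"
      by metis
    obtain B where B: "\<forall>a\<in>B. sf_coeff f a \<noteq> 0"
      "f = (\<Sum>a\<in>B. sf_scale (sf_coeff f a) (mono_sym (part_of a)))"
      using symfun_expand[of f] by blast
    have "\<phi> f = (\<Sum>a\<in>B. \<phi> (sf_scale (sf_coeff f a) (mono_sym (part_of a))))"
      by (subst B(2)) (rule \<phi>_sum[OF spec])
    also have "\<dots> = q ^ Suc n * to_fract (\<Sum>a\<in>B. S a)"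
      using B(1) S by (simp add: sum_distrib_left)
    finally have "\<phi> (elem_sym l) * \<phi> (mono_sym \<nu>) - \<phi> (mono_sym \<mu>) = q ^ Suc n * to_fract (\<Sum>a\<in>B. S a)"
      by (simp add: f_def \<phi>_diff[OF spec] \<phi>_mult[OF spec])
    then have "\<phi> (mono_sym \<mu>) = \<phi> (elem_sym l) * \<phi> (mono_sym \<nu>) - q ^ Suc n * to_fract (\<Sum>a\<in>B. S a)"
      by (simp add: algebra_simps)
    also have "\<phi> (elem_sym l) = q ^ (l choose 2) * to_fract [:1 / of_nat (fact l):]"
    proof -
      have "[:1 / of_nat (fact l) :: rat:] * of_nat (fact l) = 1"
        by (simp add: of_nat_poly one_pCons del: of_nat_fact)
      then have "to_fract [:1 / of_nat (fact l) :: rat:] * of_nat (fact l) = 1"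
        by (metis to_fract_1 to_fract_mult to_fract_of_nat)
      then show ?thesis
        unfolding \<phi>_elem_sym[OF spec] by (simp add: field_simps)
    qed
    finally have "\<phi> (mono_sym \<mu>) = q ^ n *
        to_fract ([:1 / of_nat (fact l):] * r - [:0, 1:] * (\<Sum>a\<in>B. S a))"
      unfolding r n power_Suc power_add to_fract_diff to_fract_mult q_def[symmetric]
      by (simp only: algebra_simps)
    \<comment> \<open>The constant term is that of \<open>r\<close> divided by l!.\<close>
    moreover have "coeff ([:1 / of_nat (fact l):] * r - [:0, 1:] * (\<Sum>a\<in>B. S a)) 0 \<noteq> 0"
      using r(2) by (simp add: coeff_mult)
    ultimately show ?thesis unfolding n_def by blast
  qed
qed

section \<open>From \<open>J_int\<close> to the polynomials of the theorem\<close>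

lemma one_minus_q_neq_0: "1 - q \<noteq> 0"
proof
  assume "1 - q = 0"
  then have "to_fract ([:1, -1:] :: rat poly) = 0" by (simp add: q_def one_pCons flip: to_fract_1 to_fract_diff)
  then show False by simp
qed

lemma q_neq_0: "q \<noteq> 0"
  by (simp add: q_def)

text \<open>\<open>J_int \<mu>\<close> times a power of 1 - q equals q^n(\<mu>) times a polynomial
  with nonzero constant term. As 1 - q is 1 at q = 0, the whole power of q sits in
  \<open>J_int \<mu>\<close>.\<close>

lemma J_int_factor:
  assumes spec: "is_specialization \<phi>" and part: "is_partition \<mu>" and pos: "sum_list \<mu> > 0"
  shows "\<exists>P. J_int \<mu> = monom 1 (part_n \<mu>) * P \<and> coeff P 0 \<noteq> 0"
proof -
  let ?n = "part_n \<mu>" and ?d = "sum_list \<mu> - length \<mu>"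
  let ?c = "of_nat (fact (sum_list \<mu> - 1) * mult_fact \<mu>)"
  have \<mu>: "0 \<notin> set \<mu>" "\<mu> \<noteq> []" using part pos by (auto simp: is_partition_def)
  obtain r where r: "\<phi> (mono_sym \<mu>) = q ^ ?n * to_fract r" "coeff r 0 \<noteq> 0"
    using specialization_order[OF spec part] by blast
  have "to_fract ([:1, -1:] ^ ?d * of_int_poly (J_int \<mu>)) = (1 - q) ^ ?d * int_frac (J_int \<mu>)"
    by (simp add: q_def one_pCons flip: to_fract_1 to_fract_diff)
  also have "\<dots> = ?c * (q ^ ?n * to_fract r)"
    using aug_val_J_int[OF spec \<mu>] unfolding aug_val_eq[OF spec] r by (simp add: mult_ac)
  also have "\<dots> = to_fract ([:0, 1:] ^ ?n * (?c * r))"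
    by (simp add: q_def del: of_nat_mult)
  finally have eq: "[:1, -1:] ^ ?d * of_int_poly (J_int \<mu>) = [:0, 1:] ^ ?n * (?c * r)"
    by (simp only: to_fract_eq_iff)
  have "J_int \<mu> \<noteq> 0" using J_int_degree[OF \<mu>] by auto
  then have ne: "of_int_poly (J_int \<mu>) \<noteq> 0" by (auto simp: poly_eq_iff)
  have "monom 1 ?n dvd [:1, -1:] ^ ?d * of_int_poly (J_int \<mu>)"
    unfolding eq by (simp add: monom_altdef)
  moreover have "order 0 ([:1, -1:] ^ ?d * of_int_poly (J_int \<mu>)) = order 0 (of_int_poly (J_int \<mu>))"
    using ne by (subst order_mult) (auto simp: order_0I)
  ultimately have "monom 1 ?n dvd of_int_poly (J_int \<mu>)"
    using ne by (simp add: monom_1_dvd_iff)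
  \<comment> \<open>Divisibility by a power of the variable means vanishing of low coefficients, so
    it descends from rational to integer coefficients.\<close>
  then have "monom 1 ?n dvd J_int \<mu>" by (simp add: monom_1_dvd_iff')
  then obtain P where P: "J_int \<mu> = monom 1 ?n * P" by (rule dvdE)
  have "[:1, -1:] ^ ?d * of_int_poly P = ?c * r"
  proof -
    have "of_int_poly (monom 1 ?n) = [:0, 1:] ^ ?n" by (simp add: monom_altdef)
    then have "[:0, 1:] ^ ?n * ([:1, -1:] ^ ?d * of_int_poly P) = [:0, 1:] ^ ?n * (?c * r)"
      using eq unfolding P by (simp add: mult_ac)
    then show ?thesis by (simp del: of_nat_mult)
  qed
  then have "poly ([:1, -1:] ^ ?d * of_int_poly P) 0 = poly (?c * r) 0" by (rule arg_cong)
  then have "poly (of_int_poly P) 0 = ?c * poly r 0" by (simp del: of_nat_mult)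
  then have "of_int (coeff P 0) \<noteq> (0 :: rat)"
    using r(2) mult_fact_pos[of \<mu>] by (simp add: poly_0_coeff_0)
  then show ?thesis using P by auto
qed

text \<open>Existence comes from \<open>J_int\<close> divided by (|\<mu>| - 1)!, uniqueness from 1 -
  q being nonzero; so the definite description in \<open>M_poly\<close> denotes this
  solution.\<close>

lemma M_poly_eq:
  assumes spec: "is_specialization \<phi>" and \<mu>: "0 \<notin> set \<mu>" "\<mu> \<noteq> []"
  shows "of_nat (mult_fact \<mu>) * \<phi> (mono_sym \<mu>)
      = (1 - q) ^ (sum_list \<mu> - length \<mu>) * to_fract (M_poly \<phi> \<mu>)"
    and "of_nat (fact (sum_list \<mu> - 1)) * to_fract (M_poly \<phi> \<mu>) = int_frac (J_int \<mu>)"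
proof -
  let ?d = "sum_list \<mu> - length \<mu>" and ?f = "fact (sum_list \<mu> - 1) :: nat"
  define M where "M = smult (1 / of_nat ?f) (of_int_poly (J_int \<mu>))"
  have ne: "(1 - q) ^ ?d \<noteq> 0" using one_minus_q_neq_0 by simp
  have f: "(of_nat ?f :: ratfun) \<noteq> 0" by simp
  have "of_nat ?f * M = of_int_poly (J_int \<mu>)"
    by (simp add: M_def of_nat_poly del: of_nat_fact)
  then have M: "of_nat ?f * to_fract M = int_frac (J_int \<mu>)"
    by (metis to_fract_mult to_fract_of_nat)
  have "of_nat ?f * (of_nat (mult_fact \<mu>) * \<phi> (mono_sym \<mu>)) = of_nat ?f * ((1 - q) ^ ?d * to_fract M)"
    using aug_val_J_int[OF spec \<mu>] M unfolding aug_val_eq[OF spec] by (simp add: mult_ac)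
  then have eq: "of_nat (mult_fact \<mu>) * \<phi> (mono_sym \<mu>) = (1 - q) ^ ?d * to_fract M"
    using f by (simp del: of_nat_fact)
  have "M_poly \<phi> \<mu> = M"
    unfolding M_poly_def by (intro the_equality eq) (metis eq mult_cancel_left ne to_fract_eq_iff)
  with eq M show "of_nat (mult_fact \<mu>) * \<phi> (mono_sym \<mu>) = (1 - q) ^ ?d * to_fract (M_poly \<phi> \<mu>)"
    and "of_nat ?f * to_fract (M_poly \<phi> \<mu>) = int_frac (J_int \<mu>)" by auto
qed

text \<open>The same existence and uniqueness argument, with \<open>tree_inv\<close> as
  witness.\<close>

lemma J_poly_eq:
  assumes spec: "is_specialization \<phi>" and n: "n \<ge> 1"
  shows "J_poly \<phi> n = of_int_poly (tree_inv (n - 1))"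
    and "\<phi> (mono_sym [n]) = (1 - q) ^ (n - 1) / of_nat (fact (n - 1)) * to_fract (J_poly \<phi> n)"
proof -
  let ?J = "of_int_poly (tree_inv (n - 1))"
  have eq: "\<phi> (mono_sym [n]) = (1 - q) ^ (n - 1) / of_nat (fact (n - 1)) * to_fract ?J"
    using aug_val_single[OF spec, of n] n unfolding aug_val_eq[OF spec]
    by (simp add: field_simps mult_fact_Cons)
  show "J_poly \<phi> n = ?J"
    unfolding J_poly_def using one_minus_q_neq_0 by (intro the_equality eq) (simp add: eq)
  with eq show "\<phi> (mono_sym [n]) = (1 - q) ^ (n - 1) / of_nat (fact (n - 1)) * to_fract (J_poly \<phi> n)"
    by simp
qed

theorem corollary3p5:
  fixes \<phi> :: "ratfun symfun \<Rightarrow> ratfun"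
  assumes "is_specialization \<phi>"
  shows "(\<forall>\<mu>. is_partition \<mu> \<and> sum_list \<mu> > 0 \<longrightarrow>
           \<phi> (mono_sym \<mu>) = (1 - q) ^ (sum_list \<mu> - length \<mu>)
             * (q ^ part_n \<mu> / (of_nat (fact (sum_list \<mu> - 1)) * of_nat (mult_fact \<mu>)))
             * J_part \<phi> \<mu>
           \<and> (\<exists>P :: int poly.
                J_part \<phi> \<mu> = to_fract (map_poly rat_of_int P)
                \<and> coeff P 0 \<noteq> 0
                \<and> int (degree P) = int ((sum_list \<mu> - 1) choose 2) + int (length \<mu>) - 1
                    - int (part_n \<mu>)))
         \<and> (\<forall>n\<ge>1. \<phi> (mono_sym [n]) = (1 - q) ^ (n - 1) / of_nat (fact (n - 1)) * to_fract (J_poly \<phi> n)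
           \<and> J_part \<phi> [n] = to_fract (J_poly \<phi> n))"
proof (intro conjI allI impI)
  fix \<mu> assume "is_partition \<mu> \<and> sum_list \<mu> > 0"
  then have part: "is_partition \<mu>" and pos: "sum_list \<mu> > 0" by auto
  then have \<mu>: "0 \<notin> set \<mu>" "\<mu> \<noteq> []" by (auto simp: is_partition_def)
  note M = M_poly_eq[OF assms \<mu>]
  have "(of_nat (mult_fact \<mu>) :: ratfun) \<noteq> 0" using mult_fact_pos[of \<mu>] by simp
  then show "\<phi> (mono_sym \<mu>) = (1 - q) ^ (sum_list \<mu> - length \<mu>)
      * (q ^ part_n \<mu> / (of_nat (fact (sum_list \<mu> - 1)) * of_nat (mult_fact \<mu>))) * J_part \<phi> \<mu>"
    using M(1) q_neq_0 by (simp add: J_part_def field_simps)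
  obtain P where P: "J_int \<mu> = monom 1 (part_n \<mu>) * P" "coeff P 0 \<noteq> 0"
    using J_int_factor[OF assms part pos] by blast
  have "int_frac (J_int \<mu>) = q ^ part_n \<mu> * int_frac P"
    unfolding P(1) by (simp add: monom_altdef q_def)
  then have "J_part \<phi> \<mu> = to_fract (map_poly rat_of_int P)"
    unfolding J_part_def M(2) using q_neq_0 by (simp add: of_int_poly_def)
  moreover have "int (degree P) = int ((sum_list \<mu> - 1) choose 2) + int (length \<mu>) - 1 - int (part_n \<mu>)"
  proof -
    \<comment> \<open>The degree bound is attained because the coefficient there is a factorial,
      hence nonzero.\<close>
    have "degree (J_int \<mu>) = ((sum_list \<mu> - 1) choose 2) + length \<mu> - 1"
      using J_int_degree[OF \<mu>] by (intro antisym le_degree) auto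
    moreover have "degree (J_int \<mu>) = part_n \<mu> + degree P"
      unfolding P(1) using P(2) by (subst degree_mult_eq) (auto simp: degree_monom_eq)
    moreover have "length \<mu> > 0" using \<mu> by simp
    ultimately show ?thesis by linarith
  qed
  ultimately show "\<exists>P :: int poly. J_part \<phi> \<mu> = to_fract (map_poly rat_of_int P) \<and> coeff P 0 \<noteq> 0
      \<and> int (degree P) = int ((sum_list \<mu> - 1) choose 2) + int (length \<mu>) - 1 - int (part_n \<mu>)"
    using P(2) by blast
next
  fix n :: nat assume n: "n \<ge> 1"
  note J = J_poly_eq[OF assms n]
  show "\<phi> (mono_sym [n]) = (1 - q) ^ (n - 1) / of_nat (fact (n - 1)) * to_fract (J_poly \<phi> n)"
    by (rule J(2))
  \<comment> \<open>For one part n(\<mu>) = 0 and \<open>J_int [n]\<close> is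
    \<open>tree_inv (n - 1)\<close>.\<close>
  show "J_part \<phi> [n] = to_fract (J_poly \<phi> n)"
    using M_poly_eq(2)[OF assms, of "[n]"] n
    by (simp add: J_part_def J(1) part_n_def)
qed

end
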